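(* Let $L>0$, and let $\bar\rho>0$, $\bar\theta>0$, $R>0$, $c_v>0$, $\kappa>0$, $\mu>0$, $\lambda$ be constants with $\lambda+\mu\ge0$. Let $H^1_m(0,L)=\{\rho\in H^1(0,L):\int_0^L\rho(x)\,dx=0\}$. Consider the control system \[ \begin{aligned} &\rho_t+\bar\rho\,u_x=0,\\ &u_t-\tfrac{\lambda+2\mu}{\bar\rho}u_{xx}+\tfrac{R\bar\theta}{\bar\rho}\rho_x+R\theta_x=g,\\ &\theta_t-\tfrac{\kappa}{\bar\rho c_v}\theta_{xx}+\tfrac{R\bar\theta}{c_v}u_x=h, \end{aligned} \quad\text{in }(0,L)\times(0,T), \] with $\rho(0)=\rho_0$, $u(0)=u_0$, $\theta(0)=\theta_0$ in $(0,L)$, and $u(0,t)=u(L,t)=0$, $\theta(0,t)=\theta(L,t)=0$ for $t>0$. Then for every $(\rho_0,u_0,\theta_0)\in H^1_m(0,L)\times L^2(0,L)\times L^2(0,L)$ and every $T>0$ there exist controls $g\in L^2(0,T;L^2(0,L))$ and $h\in L^2(0,T;L^2(0,L))$ such that the solution satisfies $(\rho,u,\theta)(x,T)=0$ for all $x\in(0,L)$.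
   Context: The controls act on the whole interval in the velocity and temperature equations; no control acts in the density equation. *)

theory Defs
  imports "HOL-Analysis.Analysis"
begin

definition L2_on :: "'a::euclidean_space set \<Rightarrow> ('a \<Rightarrow> real) \<Rightarrow> bool" where
  "L2_on S f \<longleftrightarrow> f measurable_on S \<and> (\<lambda>x. (f x)^2) integrable_on S"

definition test_fun :: "real \<Rightarrow> (real \<Rightarrow> real) \<Rightarrow> bool" where
  "test_fun L \<phi> \<longleftrightarrow> (\<forall>x. \<phi> differentiable (at x)) \<and> continuous_on UNIV (deriv \<phi>) \<and>
     (\<exists>a b. 0 < a \<and> a \<le> b \<and> b < L \<and> (\<forall>x. x \<notin> {a..b} \<longrightarrow> \<phi> x = 0))"

definition has_weak_deriv :: "real \<Rightarrow> (real \<Rightarrow> real) \<Rightarrow> (real \<Rightarrow> real) \<Rightarrow> bool" where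
  "has_weak_deriv L f g \<longleftrightarrow> (\<forall>\<phi>. test_fun L \<phi> \<longrightarrow>
     integral {0..L} (\<lambda>x. f x * deriv \<phi> x) = - integral {0..L} (\<lambda>x. g x * \<phi> x))"

definition H1 :: "real \<Rightarrow> (real \<Rightarrow> real) \<Rightarrow> bool" where
  "H1 L f \<longleftrightarrow> L2_on {0..L} f \<and> (\<exists>g. L2_on {0..L} g \<and> has_weak_deriv L f g)"

definition H1m :: "real \<Rightarrow> (real \<Rightarrow> real) \<Rightarrow> bool" where
  "H1m L f \<longleftrightarrow> H1 L f \<and> integral {0..L} f = 0"

definition dx :: "(real \<Rightarrow> real \<Rightarrow> real) \<Rightarrow> real \<Rightarrow> real \<Rightarrow> real" where
  "dx \<psi> x t = deriv (\<lambda>y. \<psi> y t) x"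

definition dt :: "(real \<Rightarrow> real \<Rightarrow> real) \<Rightarrow> real \<Rightarrow> real \<Rightarrow> real" where
  "dt \<psi> x t = deriv (\<lambda>s. \<psi> x s) t"

definition C1_2 :: "(real \<Rightarrow> real \<Rightarrow> real) \<Rightarrow> bool" where
  "C1_2 \<psi> \<longleftrightarrow>
     (\<forall>x t. (\<lambda>y. \<psi> y t) differentiable (at x) \<and> (\<lambda>s. \<psi> x s) differentiable (at t)) \<and>
     continuous_on UNIV (\<lambda>(x,t). \<psi> x t) \<and>
     continuous_on UNIV (\<lambda>(x,t). dx \<psi> x t) \<and>
     continuous_on UNIV (\<lambda>(x,t). dt \<psi> x t)"

definition Qint :: "real \<Rightarrow> real \<Rightarrow> (real \<Rightarrow> real \<Rightarrow> real) \<Rightarrow> real" where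
  "Qint L T f = integral ({0..L} \<times> {0..T}) (\<lambda>(x,t). f x t)"

definition L2Q :: "real \<Rightarrow> real \<Rightarrow> (real \<Rightarrow> real \<Rightarrow> real) \<Rightarrow> bool" where
  "L2Q L T f \<longleftrightarrow> L2_on ({0..L} \<times> {0..T}) (\<lambda>(x,t). f x t)"

(* w \<in> L^2(0,T;H^1_0(0,L)) with spatial derivative wx \<in> L^2(Q).
   Test functions are NOT required to vanish at x = 0, L: this encodes the
   homogeneous Dirichlet condition w(0,t) = w(L,t) = 0 (zero trace). *)
definition L2H10 :: "real \<Rightarrow> real \<Rightarrow> (real \<Rightarrow> real \<Rightarrow> real) \<Rightarrow> (real \<Rightarrow> real \<Rightarrow> real) \<Rightarrow> bool" where
  "L2H10 L T w wx \<longleftrightarrow> L2Q L T w \<and> L2Q L T wx \<and>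
     (\<forall>\<psi>. C1_2 \<psi> \<longrightarrow> Qint L T (\<lambda>x t. w x t * dx \<psi> x t) = - Qint L T (\<lambda>x t. wx x t * \<psi> x t))"

(* Weak solution on (0,L) x (0,T) of
     rho_t + rhobar u_x = 0,
     u_t - (lam+2mu)/rhobar u_xx + R thetabar/rhobar rho_x + R theta_x = g,
     theta_t - kappa/(rhobar cv) theta_xx + R thetabar/cv u_x = h,
   with u = theta = 0 at x = 0, L, initial data (rho0,u0,theta0) at t = 0,
   and whose state at time T is (rhoT,uT,thetaT).
   Test functions are C^1 on [0,L] x [0,T] and are not required to vanish at t = 0
   or t = T, so that the identities also encode the initial and final states. *)
definition weak_solution ::
  "real \<Rightarrow> real \<Rightarrow> real \<Rightarrow> real \<Rightarrow> real \<Rightarrow> real \<Rightarrow> real \<Rightarrow> real \<Rightarrow> real \<Rightarrow>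
   (real \<Rightarrow> real \<Rightarrow> real) \<Rightarrow> (real \<Rightarrow> real \<Rightarrow> real) \<Rightarrow>
   (real \<Rightarrow> real) \<Rightarrow> (real \<Rightarrow> real) \<Rightarrow> (real \<Rightarrow> real) \<Rightarrow>
   (real \<Rightarrow> real) \<Rightarrow> (real \<Rightarrow> real) \<Rightarrow> (real \<Rightarrow> real) \<Rightarrow>
   (real \<Rightarrow> real \<Rightarrow> real) \<Rightarrow> (real \<Rightarrow> real \<Rightarrow> real) \<Rightarrow> (real \<Rightarrow> real \<Rightarrow> real) \<Rightarrow> bool" where
  "weak_solution L T rhobar thetabar R cv kappa mu lam g h rho0 u0 theta0 rhoT uT thetaT rho u theta \<longleftrightarrow>
     L2Q L T rho \<and>
     (\<exists>ux thetax. L2H10 L T u ux \<and> L2H10 L T theta thetax \<and>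
       (\<forall>\<phi>. C1_2 \<phi> \<longrightarrow>
          integral {0..L} (\<lambda>x. rhoT x * \<phi> x T) - integral {0..L} (\<lambda>x. rho0 x * \<phi> x 0)
          - Qint L T (\<lambda>x t. rho x t * dt \<phi> x t)
          + rhobar * Qint L T (\<lambda>x t. ux x t * \<phi> x t) = 0) \<and>
       (\<forall>\<phi>. C1_2 \<phi> \<longrightarrow> (\<forall>t. \<phi> 0 t = 0 \<and> \<phi> L t = 0) \<longrightarrow>
          integral {0..L} (\<lambda>x. uT x * \<phi> x T) - integral {0..L} (\<lambda>x. u0 x * \<phi> x 0)
          - Qint L T (\<lambda>x t. u x t * dt \<phi> x t)
          + (lam + 2 * mu) / rhobar * Qint L T (\<lambda>x t. ux x t * dx \<phi> x t)
          - R * thetabar / rhobar * Qint L T (\<lambda>x t. rho x t * dx \<phi> x t)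
          + R * Qint L T (\<lambda>x t. thetax x t * \<phi> x t)
          = Qint L T (\<lambda>x t. g x t * \<phi> x t)) \<and>
       (\<forall>\<phi>. C1_2 \<phi> \<longrightarrow> (\<forall>t. \<phi> 0 t = 0 \<and> \<phi> L t = 0) \<longrightarrow>
          integral {0..L} (\<lambda>x. thetaT x * \<phi> x T) - integral {0..L} (\<lambda>x. theta0 x * \<phi> x 0)
          - Qint L T (\<lambda>x t. theta x t * dt \<phi> x t)
          + kappa / (rhobar * cv) * Qint L T (\<lambda>x t. thetax x t * dx \<phi> x t)
          + R * thetabar / cv * Qint L T (\<lambda>x t. ux x t * \<phi> x t)
          = Qint L T (\<lambda>x t. h x t * \<phi> x t)))"

end

theory Submission
  imports Defs
begin

text \<open>Since the controls act everywhere in the velocity and temperature equations, it suffices to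
  exhibit trajectories that reach zero at time \<open>T\<close> and for which the equations leave a square integrable residual.
  The initial values \<open>u\<^sub>0\<close> and \<open>\<theta>\<^sub>0\<close> are only square integrable, so near \<open>t = 0\<close> the trajectories must follow the heat flow:
  they are sine series whose coefficients solve the modal heat equations up to a source bounded uniformly in the mode.
  The uncontrolled density obeys \<open>\<rho>\<^sub>t = - \<rho>\<^sub>b u\<^sub>x\<close>, with \<open>\<rho>\<^sub>b\<close> the constant background density,
  hence vanishes at time \<open>T\<close> iff \<open>\<rho>\<^sub>b \<integral>\<^sub>0\<^sup>T u dt\<close> is the primitive of \<open>\<rho>\<^sub>0\<close>. The modal profiles for \<open>u\<^sub>0\<close> are chosen
  with mean zero in time, and a separate velocity \<open>b(t) \<integral>\<^sub>0\<^sup>x \<rho>\<^sub>0\<close> removes the initial density;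
  its residual involves \<open>\<rho>\<^sub>0'\<close>, which is where \<open>\<rho>\<^sub>0 \<in> H\<^sup>1\<close> is needed.\<close>

text \<open>Multiplying \<open>exp (- m * t)\<close> by a nonnegative cutoff would leave each
  velocity mode with positive time mean, and the density it displaces would not come back. The
  cutoff \<open>chi = (1 - t / T)^2\<close> is therefore put on the primitive
  \<open>y = (1 - exp (- m * t)) / m\<close>, and the velocity coefficient is
  \<open>q = (chi * y)'\<close>. Its mean is zero because \<open>chi * y\<close> vanishes at both
  ends, and the double zero of \<open>chi\<close> gives \<open>q T = 0\<close>. Since
  \<open>y'' + m * y' = 0\<close>, the two terms of size \<open>m\<close> in
  \<open>q' + m * q\<close> cancel. The other obstacle is the pressure gradient: the displaced
  density contains one space derivative of the velocity, and its gradient a second one, while the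
  initial velocity has none. Integrating in time gains \<open>1 / m\<close>, and \<open>m\<close> is
  a multiple of the squared frequency, so the balance is exact and leaves nothing to spare. No
  regularity of a limit is ever proved. Velocity, its gradient, the source, the displaced density
  and its gradient are limits of separate orthogonal series; the equations linking them are checked
  mode by mode against a test function and then summed.\<close>

section \<open>Square integrable functions and orthogonal series\<close>

definition sqint :: "'a measure \<Rightarrow> ('a \<Rightarrow> real) \<Rightarrow> bool" where
  "sqint M f \<longleftrightarrow> f \<in> borel_measurable M \<and> integrable M (\<lambda>x. (f x)\<^sup>2)"

lemma sqint_mult_integrable:
  assumes "sqint M f" "sqint M g"
  shows "integrable M (\<lambda>x. f x * g x)"
proof (rule Bochner_Integration.integrable_bound)
  show "integrable M (\<lambda>x. (f x)\<^sup>2 + (g x)\<^sup>2)"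
    using assms by (auto simp: sqint_def)
  show "(\<lambda>x. f x * g x) \<in> borel_measurable M"
    using assms by (auto simp: sqint_def)
  have "\<bar>f x * g x\<bar> \<le> (f x)\<^sup>2 + (g x)\<^sup>2" for x
  proof -
    have "2 * (\<bar>f x\<bar> * \<bar>g x\<bar>) \<le> \<bar>f x\<bar>\<^sup>2 + \<bar>g x\<bar>\<^sup>2"
      using sum_squares_bound[of "\<bar>f x\<bar>" "\<bar>g x\<bar>"] by simp
    moreover have "0 \<le> \<bar>f x\<bar> * \<bar>g x\<bar>" by simp
    ultimately show ?thesis unfolding abs_mult power2_abs by linarith
  qed
  then show "AE x in M. norm (f x * g x) \<le> norm ((f x)\<^sup>2 + (g x)\<^sup>2)"
    by simp
qed

lemma sqint_add:
  assumes "sqint M f" "sqint M g"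
  shows "sqint M (\<lambda>x. f x + g x)"
  using assms sqint_mult_integrable[OF assms]
  by (auto simp: sqint_def power2_sum mult.assoc)

lemma sqint_cmult: "sqint M f \<Longrightarrow> sqint M (\<lambda>x. c * f x)"
  by (auto simp: sqint_def power_mult_distrib)

lemma sqint_diff: "sqint M f \<Longrightarrow> sqint M g \<Longrightarrow> sqint M (\<lambda>x. f x - g x)"
  using sqint_add[OF _ sqint_cmult[of M g "-1"]] by simp

lemma sqint_sum:
  assumes "\<And>i. i \<in> I \<Longrightarrow> sqint M (f i)"
  shows "sqint M (\<lambda>x. \<Sum>i\<in>I. f i x)"
  using assms
proof (induction I rule: infinite_finite_induct)
  case (insert i I) then show ?case by (simp add: sqint_add)
qed (auto simp: sqint_def)

lemma Cauchy_Schwarz_integral: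
  assumes "sqint M f" "sqint M g"
  shows "(\<integral>x. f x * g x \<partial>M)\<^sup>2 \<le> (\<integral>x. (f x)\<^sup>2 \<partial>M) * (\<integral>x. (g x)\<^sup>2 \<partial>M)"
proof -
  define A B C where "A = (\<integral>x. (f x)\<^sup>2 \<partial>M)" and "B = (\<integral>x. f x * g x \<partial>M)" and "C = (\<integral>x. (g x)\<^sup>2 \<partial>M)"
  have fg: "integrable M (\<lambda>x. f x * g x)" by (rule sqint_mult_integrable[OF assms])
  have f2: "integrable M (\<lambda>x. (f x)\<^sup>2)" and g2: "integrable M (\<lambda>x. (g x)\<^sup>2)"
    using assms by (auto simp: sqint_def)
  have quad: "0 \<le> s\<^sup>2 * A + 2 * s * t * B + t\<^sup>2 * C" for s t
  proof -
    have "0 \<le> (\<integral>x. (s * f x + t * g x)\<^sup>2 \<partial>M)" by simp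
    also have "(\<lambda>x. (s * f x + t * g x)\<^sup>2) =
        (\<lambda>x. s\<^sup>2 * (f x)\<^sup>2 + (2 * s * t) * (f x * g x) + t\<^sup>2 * (g x)\<^sup>2)"
      by (auto simp: power2_eq_square algebra_simps)
    also have "(\<integral>x. s\<^sup>2 * (f x)\<^sup>2 + (2 * s * t) * (f x * g x) + t\<^sup>2 * (g x)\<^sup>2 \<partial>M) =
        s\<^sup>2 * A + 2 * s * t * B + t\<^sup>2 * C"
      using fg f2 g2 by (simp add: A_def B_def C_def)
    finally show ?thesis .
  qed
  have "A \<ge> 0" "C \<ge> 0" by (simp_all add: A_def C_def)
  show ?thesis
  \<comment> \<open>For \<open>C = 0\<close> and \<open>s = 1\<close> the form is affine in
    \<open>t\<close>, and unless \<open>B = 0\<close> the chosen \<open>t\<close> gives the value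
    -1. Otherwise \<open>s = C\<close>, \<open>t = - B\<close> turns the form into
    \<open>C * (A * C - B^2)\<close>.\<close>
  proof (cases "C = 0")
    case True
    have "B = 0"
    proof (rule ccontr)
      assume "B \<noteq> 0"
      have "0 \<le> A + 2 * (- (A + 1) / (2 * B)) * B"
        using quad[of 1 "- (A + 1) / (2 * B)"] True by simp
      also have "\<dots> = -1" using \<open>B \<noteq> 0\<close> by (simp add: field_simps)
      finally show False by simp
    qed
    then show ?thesis using True by (simp add: A_def B_def C_def)
  next
    case False
    then have "C > 0" using \<open>C \<ge> 0\<close> by simp
    have "0 \<le> C * (A * C - B\<^sup>2)"
      using quad[of C "- B"] by (simp add: power2_eq_square algebra_simps)
    then show ?thesis
      using \<open>C > 0\<close> by (simp add: zero_le_mult_iff A_def B_def C_def)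
  qed
qed

lemma tendsto_inner_L2:
  assumes f: "\<And>n. sqint M (f n)" and w: "sqint M w" and g: "sqint M g"
    and lim: "(\<lambda>n. \<integral>x. (f n x - w x)\<^sup>2 \<partial>M) \<longlonglongrightarrow> 0"
  shows "(\<lambda>n. \<integral>x. f n x * g x \<partial>M) \<longlonglongrightarrow> (\<integral>x. w x * g x \<partial>M)"
proof -
  have eq: "(\<integral>x. (f n x - w x) * g x \<partial>M) = (\<integral>x. f n x * g x \<partial>M) - (\<integral>x. w x * g x \<partial>M)" for n
    using sqint_mult_integrable[OF f g] sqint_mult_integrable[OF w g] by (simp add: left_diff_distrib)
  have "(\<lambda>n. (\<integral>x. (f n x - w x) * g x \<partial>M)\<^sup>2) \<longlonglongrightarrow> 0"
  proof (rule tendsto_sandwich[where f = "\<lambda>_. 0"])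
    show "\<forall>\<^sub>F n in sequentially. (\<integral>x. (f n x - w x) * g x \<partial>M)\<^sup>2
        \<le> (\<integral>x. (f n x - w x)\<^sup>2 \<partial>M) * (\<integral>x. (g x)\<^sup>2 \<partial>M)"
      by (intro always_eventually allI Cauchy_Schwarz_integral sqint_diff f w g)
    show "(\<lambda>n. (\<integral>x. (f n x - w x)\<^sup>2 \<partial>M) * (\<integral>x. (g x)\<^sup>2 \<partial>M)) \<longlonglongrightarrow> 0"
      using tendsto_mult_left_zero[OF lim] .
  qed auto
  then have "(\<lambda>n. \<integral>x. (f n x - w x) * g x \<partial>M) \<longlonglongrightarrow> 0"
    by (simp add: power_tendsto_0_iff)
  then show ?thesis
    by (simp add: eq LIM_zero_iff)
qed

text \<open>Along a subsequence the increments \<open>d k\<close> satisfy \<open>\<integral>(d k)\<^sup>2 \<le> 8\<^sup>-\<^sup>k\<close>, and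
  \<open>\<bar>d\<bar> \<le> 2\<^sup>-\<^sup>k + 2\<^sup>k d\<^sup>2\<close> turns this into almost everywhere absolute convergence.\<close>

theorem Riesz_Fischer:
  fixes f :: "nat \<Rightarrow> 'a \<Rightarrow> real"
  assumes f: "\<And>n. sqint M (f n)"
    and Cauchy: "\<And>e. e > 0 \<Longrightarrow> \<exists>N. \<forall>m\<ge>N. \<forall>n\<ge>N. (\<integral>x. (f m x - f n x)\<^sup>2 \<partial>M) \<le> e"
  obtains w where "sqint M w" "(\<lambda>n. \<integral>x. (f n x - w x)\<^sup>2 \<partial>M) \<longlonglongrightarrow> 0"
proof -
  have [measurable]: "f n \<in> borel_measurable M" for n using f by (simp add: sqint_def)
  have sq: "integrable M (\<lambda>x. (f m x - f n x)\<^sup>2)" for m n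
    using sqint_diff[OF f f] by (simp add: sqint_def)
  have nn: "(\<integral>\<^sup>+x. ennreal ((f m x - f n x)\<^sup>2) \<partial>M) = ennreal (\<integral>x. (f m x - f n x)\<^sup>2 \<partial>M)" for m n
    by (intro nn_integral_eq_integral sq) simp
  have "\<exists>N. \<forall>k. (\<forall>m\<ge>N k. \<forall>n\<ge>N k. (\<integral>x. (f m x - f n x)\<^sup>2 \<partial>M) \<le> (1/8)^k)"
    by (intro choice allI Cauchy) simp
  then obtain N where N: "\<And>k m n. m \<ge> N k \<Longrightarrow> n \<ge> N k \<Longrightarrow> (\<integral>x. (f m x - f n x)\<^sup>2 \<partial>M) \<le> (1/8)^k"
    by blast
  \<comment> \<open>Summing all thresholds up to \<open>k\<close> makes \<open>r\<close> monotone
    and at least \<open>N k\<close>; the summand \<open>k\<close> makes it unbounded.\<close>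
  define r where "r k = k + (\<Sum>i\<le>k. N i)" for k
  have rN: "r k \<ge> N k" for k
    unfolding r_def using member_le_sum[of k "{..k}" N] by simp
  have rS: "r (Suc k) \<ge> r k" for k by (simp add: r_def)
  have rk: "r k \<ge> k" for k by (simp add: r_def)
  define d where "d k x = f (r (Suc k)) x - f (r k) x" for k x
  have [measurable]: "d k \<in> borel_measurable M" for k unfolding d_def by measurable
  \<comment> \<open>The weight \<open>2^k\<close> is the one in the pointwise bound on the
    increments; it weakens \<open>8^-k\<close> to \<open>4^-k\<close>, which is still
    summable.\<close>
  have dint: "(\<integral>\<^sup>+x. ennreal (2^k * (d k x)\<^sup>2) \<partial>M) \<le> ennreal ((1/4)^k)" for k
  proof -
    have "(\<integral>\<^sup>+x. ennreal (2^k * (d k x)\<^sup>2) \<partial>M) = ennreal (2^k) * (\<integral>\<^sup>+x. ennreal ((d k x)\<^sup>2) \<partial>M)"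
      by (subst nn_integral_cmult[symmetric]) (auto simp: ennreal_mult)
    also have "\<dots> \<le> ennreal (2^k) * ennreal ((1/8)^k)"
      unfolding d_def nn using rN[of k] rS[of k] N by (intro mult_left_mono ennreal_leI) auto
    also have "\<dots> = ennreal ((1/4)^k)"
      by (subst ennreal_mult[symmetric]) (auto simp: power_mult_distrib[symmetric])
    finally show ?thesis .
  qed
  have "(\<integral>\<^sup>+x. (\<Sum>k. ennreal (2^k * (d k x)\<^sup>2)) \<partial>M) = (\<Sum>k. \<integral>\<^sup>+x. ennreal (2^k * (d k x)\<^sup>2) \<partial>M)"
    by (rule nn_integral_suminf) measurable
  also have "\<dots> \<le> (\<Sum>k. ennreal ((1/4)^k))"
    by (intro suminf_le dint) auto
  also have "\<dots> = ennreal (\<Sum>k. (1/4)^k)"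
    by (intro suminf_ennreal2) (auto simp: summable_geometric)
  also have "\<dots> < \<infinity>" by simp
  finally have fin: "(\<integral>\<^sup>+x. (\<Sum>k. ennreal (2^k * (d k x)\<^sup>2)) \<partial>M) \<noteq> \<infinity>" by simp
  have "AE x in M. (\<Sum>k. ennreal (2^k * (d k x)\<^sup>2)) \<noteq> \<infinity>"
    using fin by (intro nn_integral_PInf_AE) auto
  then have conv: "AE x in M. convergent (\<lambda>k. f (r k) x)"
  proof eventually_elim
    case (elim x)
    have s1: "summable (\<lambda>k. 2^k * (d k x)\<^sup>2)"
      by (intro summable_suminf_not_top) (use elim in auto)
    have s2: "summable (\<lambda>k. (1/2::real)^k + 2^k * (d k x)\<^sup>2)"
      by (intro summable_add s1 summable_geometric) auto
    have "norm (d k x) \<le> (1/2)^k + 2^k * (d k x)\<^sup>2" for k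
    proof (cases "\<bar>d k x\<bar> \<le> (1/2)^k")
      case True then show ?thesis by (simp add: add_increasing2)
    next
      case False
      then have "1 \<le> 2^k * \<bar>d k x\<bar>" by (simp add: field_simps)
      then have "1 * \<bar>d k x\<bar> \<le> 2^k * \<bar>d k x\<bar> * \<bar>d k x\<bar>" by (intro mult_right_mono) auto
      then show ?thesis by (simp add: power2_eq_square add_increasing mult.assoc)
    qed
    then have "summable (\<lambda>k. d k x)"
      by (intro summable_comparison_test'[OF s2]) auto
    then have "convergent (\<lambda>n. \<Sum>k<n. d k x)"
      by (simp add: summable_iff_convergent)
    also have "(\<lambda>n. \<Sum>k<n. d k x) = (\<lambda>n. f (r n) x - f (r 0) x)"
      unfolding d_def by (simp add: sum_lessThan_telescope[of "\<lambda>k. f (r k) x"])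
    finally have "convergent (\<lambda>n. (f (r n) x - f (r 0) x) + f (r 0) x)"
      by (intro convergent_add convergent_const)
    then show ?case by simp
  qed
  define w where "w x = lim (\<lambda>k. f (r k) x)" for x
  have [measurable]: "w \<in> borel_measurable M" unfolding w_def by measurable
  have lim: "AE x in M. (\<lambda>k. f (r k) x) \<longlonglongrightarrow> w x"
    using conv by eventually_elim (simp add: w_def convergent_LIMSEQ_iff)
  \<comment> \<open>Fatou's lemma in the second index carries the Cauchy estimate over to the limit,
    and yields square integrability of \<open>f n - w\<close> before that of \<open>w\<close> is
    known.\<close>
  have Fatou: "(\<integral>\<^sup>+x. ennreal ((f n x - w x)\<^sup>2) \<partial>M) \<le> ennreal ((1/8)^j)" if "n \<ge> N j" for n j
  proof -
    have "(\<integral>\<^sup>+x. ennreal ((f n x - w x)\<^sup>2) \<partial>M) =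
        (\<integral>\<^sup>+x. liminf (\<lambda>k. ennreal ((f n x - f (r k) x)\<^sup>2)) \<partial>M)"
    proof (rule nn_integral_cong_AE, use lim in eventually_elim)
      case (elim x)
      then have "(\<lambda>k. ennreal ((f n x - f (r k) x)\<^sup>2)) \<longlonglongrightarrow> ennreal ((f n x - w x)\<^sup>2)"
        by (intro tendsto_intros)
      then show ?case by (rule lim_imp_Liminf[symmetric, rotated]) simp
    qed
    also have "\<dots> \<le> liminf (\<lambda>k. \<integral>\<^sup>+x. ennreal ((f n x - f (r k) x)\<^sup>2) \<partial>M)"
      by (intro nn_integral_liminf) measurable
    also have "\<dots> \<le> liminf (\<lambda>k. ennreal ((1/8)^j))"
    proof (intro Liminf_mono)
      have "N j \<le> r k" if "k \<ge> N j" for k using rk[of k] that by simp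
      then show "\<forall>\<^sub>F k in sequentially.
          (\<integral>\<^sup>+x. ennreal ((f n x - f (r k) x)\<^sup>2) \<partial>M) \<le> ennreal ((1/8)^j)"
        unfolding nn eventually_sequentially using N[of j n] \<open>n \<ge> N j\<close> by (intro exI[of _ "N j"]) (auto intro!: ennreal_leI)
    qed
    also have "\<dots> = ennreal ((1/8)^j)" by (simp add: Liminf_const)
    finally show ?thesis .
  qed
  have int: "integrable M (\<lambda>x. (f n x - w x)\<^sup>2)" if "n \<ge> N 0" for n
    using Fatou[OF that] by (intro integrableI_bounded) (auto intro: le_less_trans)
  have "sqint M (\<lambda>x. f (N 0) x - w x)" using int by (auto simp: sqint_def)
  from sqint_diff[OF f[of "N 0"] this] have w: "sqint M w" by simp
  have int': "integrable M (\<lambda>x. (f n x - w x)\<^sup>2)" for n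
    using sqint_diff[OF f w] by (simp add: sqint_def)
  have "(\<lambda>n. \<integral>x. (f n x - w x)\<^sup>2 \<partial>M) \<longlonglongrightarrow> 0"
  proof (rule LIMSEQ_I)
    fix e :: real assume "e > 0"
    then obtain j where j: "(1/8)^j < e" using real_arch_pow_inv[of e "1/8"] by auto
    have "norm ((\<integral>x. (f n x - w x)\<^sup>2 \<partial>M) - 0) < e" if "n \<ge> N j" for n
    proof -
      have "ennreal (\<integral>x. (f n x - w x)\<^sup>2 \<partial>M) \<le> ennreal ((1/8)^j)"
        using Fatou[OF that] by (subst nn_integral_eq_integral[symmetric]) (auto simp: int')
      then show ?thesis using j by (simp add: ennreal_le_iff)
    qed
    then show "\<exists>no. \<forall>n\<ge>no. norm ((\<integral>x. (f n x - w x)\<^sup>2 \<partial>M) - 0) < e" by blast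
  qed
  with w show thesis by (rule that)
qed

lemma integral_square_sum_orthogonal:
  assumes g: "\<And>n. sqint M (g n)"
    and orth: "\<And>m n. m \<noteq> n \<Longrightarrow> (\<integral>x. g m x * g n x \<partial>M) = 0" and I: "finite I"
  shows "(\<integral>x. (\<Sum>n\<in>I. g n x)\<^sup>2 \<partial>M) = (\<Sum>n\<in>I. \<integral>x. (g n x)\<^sup>2 \<partial>M)"
proof -
  have "(\<integral>x. (\<Sum>n\<in>I. g n x)\<^sup>2 \<partial>M) = (\<integral>x. (\<Sum>m\<in>I. \<Sum>n\<in>I. g m x * g n x) \<partial>M)"
    by (simp add: power2_eq_square sum_product)
  also have "\<dots> = (\<Sum>m\<in>I. \<Sum>n\<in>I. \<integral>x. g m x * g n x \<partial>M)"
    using sqint_mult_integrable[OF g g] by (simp add: Bochner_Integration.integral_sum)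
  also have "\<dots> = (\<Sum>m\<in>I. \<Sum>n\<in>I. if m = n then \<integral>x. (g m x)\<^sup>2 \<partial>M else 0)"
    by (intro sum.cong refl) (auto simp: orth power2_eq_square)
  also have "\<dots> = (\<Sum>n\<in>I. \<integral>x. (g n x)\<^sup>2 \<partial>M)"
    using I by simp
  finally show ?thesis .
qed

text \<open>By Pythagoras a block of the series has squared norm equal to the same block of the
  numerical series, so the partial sums are Cauchy. The limit is described only through its
  pairings, the form in which every later equation is tested.\<close>

theorem orthogonal_series_L2:
  fixes g :: "nat \<Rightarrow> 'a \<Rightarrow> real"
  assumes g: "\<And>n. sqint M (g n)"
    and orth: "\<And>m n. m \<noteq> n \<Longrightarrow> (\<integral>x. g m x * g n x \<partial>M) = 0"
    and summ: "summable (\<lambda>n. \<integral>x. (g n x)\<^sup>2 \<partial>M)"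
  obtains w where "sqint M w"
    "\<And>\<psi>. sqint M \<psi> \<Longrightarrow> (\<lambda>n. \<integral>x. g n x * \<psi> x \<partial>M) sums (\<integral>x. w x * \<psi> x \<partial>M)"
proof -
  define s where "s n x = (\<Sum>i<n. g i x)" for n x
  have s: "sqint M (s n)" for n unfolding s_def by (intro sqint_sum g)
  have le: "(\<integral>x. (s m x - s n x)\<^sup>2 \<partial>M) \<le> e"
    if "m \<ge> N" "n \<ge> N" "\<And>m n. m \<ge> N \<Longrightarrow> norm (\<Sum>i=m..<n. \<integral>x. (g i x)\<^sup>2 \<partial>M) < e" for m n N e
  proof -
    have *: "(\<integral>x. (s m x - s n x)\<^sup>2 \<partial>M) \<le> e" if "m \<le> n" "m \<ge> N" for m n
    proof -
      have "s n x - s m x = (\<Sum>i=m..<n. g i x)" for x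
        unfolding s_def using sum_diff_nat_ivl[of 0 m n "\<lambda>i. g i x"] \<open>m \<le> n\<close>
        by (simp add: atLeast0LessThan)
      then have "(s m x - s n x)\<^sup>2 = (\<Sum>i=m..<n. g i x)\<^sup>2" for x
        by (metis power2_commute)
      then have "(\<integral>x. (s m x - s n x)\<^sup>2 \<partial>M) = (\<Sum>i=m..<n. \<integral>x. (g i x)\<^sup>2 \<partial>M)"
        using integral_square_sum_orthogonal[where I = "{m..<n}", OF g orth] by simp
      also have "\<dots> \<le> e" using \<open>\<And>m n. m \<ge> N \<Longrightarrow> norm (\<Sum>i=m..<n. \<integral>x. (g i x)\<^sup>2 \<partial>M) < e\<close>[OF \<open>m \<ge> N\<close>, of n]
        by (simp add: abs_less_iff)
      finally show ?thesis .
    qed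
    show ?thesis
    proof (cases "m \<le> n")
      case True then show ?thesis using *[of m n] that by simp
    next
      case False then show ?thesis using *[of n m] that by (simp add: power2_commute)
    qed
  qed
  have "\<exists>N. \<forall>m\<ge>N. \<forall>n\<ge>N. (\<integral>x. (s m x - s n x)\<^sup>2 \<partial>M) \<le> e" if "e > 0" for e
    using summ that le unfolding summable_Cauchy by meson
  from Riesz_Fischer[OF s this]
  obtain w where w: "sqint M w" "(\<lambda>n. \<integral>x. (s n x - w x)\<^sup>2 \<partial>M) \<longlonglongrightarrow> 0" by blast
  show thesis
  proof (rule that[OF w(1)])
    fix \<psi> assume \<psi>: "sqint M \<psi>"
    have "(\<lambda>n. \<integral>x. s n x * \<psi> x \<partial>M) \<longlonglongrightarrow> (\<integral>x. w x * \<psi> x \<partial>M)"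
      by (rule tendsto_inner_L2[OF s w(1) \<psi> w(2)])
    moreover have "(\<integral>x. s n x * \<psi> x \<partial>M) = (\<Sum>i<n. \<integral>x. g i x * \<psi> x \<partial>M)" for n
      unfolding s_def sum_distrib_right
      by (rule Bochner_Integration.integral_sum) (rule sqint_mult_integrable[OF g \<psi>])
    ultimately show "(\<lambda>n. \<integral>x. g n x * \<psi> x \<partial>M) sums (\<integral>x. w x * \<psi> x \<partial>M)"
      by (simp add: sums_def)
  qed
qed

text \<open>Expanding the square of \<open>f\<close> minus a partial sum leaves the squared norm of
  \<open>f\<close> minus \<open>c\<close> times the sum of the squared coefficients, which cannot be
  negative. Allowing a common value \<open>c\<close> avoids normalising the sines.\<close>

lemma Bessel_inequality_summable:
  fixes e :: "nat \<Rightarrow> 'a \<Rightarrow> real"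
  assumes e: "\<And>n. sqint M (e n)" and f: "sqint M f"
    and orth: "\<And>m n. m \<noteq> n \<Longrightarrow> (\<integral>x. e m x * e n x \<partial>M) = 0"
    and norm: "\<And>n. (\<integral>x. (e n x)\<^sup>2 \<partial>M) = c" and "c > 0"
    and a: "\<And>n. a n = (\<integral>x. f x * e n x \<partial>M) / c"
  shows "summable (\<lambda>n. (a n)\<^sup>2)"
proof (rule summableI_nonneg_bounded[where x = "(\<integral>x. (f x)\<^sup>2 \<partial>M) / c"])
  fix n
  define s where "s x = (\<Sum>i<n. a i * e i x)" for x
  have ae: "sqint M (\<lambda>x. a i * e i x)" for i by (intro sqint_cmult e)
  have s: "sqint M s" unfolding s_def by (intro sqint_sum ae)
  have s2: "(\<integral>x. (s x)\<^sup>2 \<partial>M) = c * (\<Sum>i<n. (a i)\<^sup>2)"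
  proof -
    have "(\<integral>x. (s x)\<^sup>2 \<partial>M) = (\<Sum>i<n. \<integral>x. (a i * e i x)\<^sup>2 \<partial>M)"
      unfolding s_def
    proof (rule integral_square_sum_orthogonal[OF ae])
      fix i j :: nat assume "i \<noteq> j"
      have "(\<integral>x. a i * e i x * (a j * e j x) \<partial>M) = (\<integral>x. (a i * a j) * (e i x * e j x) \<partial>M)"
        by (simp add: ac_simps)
      then show "(\<integral>x. a i * e i x * (a j * e j x) \<partial>M) = 0"
        using orth[OF \<open>i \<noteq> j\<close>] by simp
    qed simp
    then show ?thesis by (simp add: power_mult_distrib norm sum_distrib_left mult.commute)
  qed
  have fs: "(\<integral>x. f x * s x \<partial>M) = c * (\<Sum>i<n. (a i)\<^sup>2)"
  proof -
    have "(\<integral>x. f x * s x \<partial>M) = (\<integral>x. (\<Sum>i<n. a i * (f x * e i x)) \<partial>M)"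
      by (simp add: s_def sum_distrib_left ac_simps)
    also have "\<dots> = (\<Sum>i<n. \<integral>x. a i * (f x * e i x) \<partial>M)"
      by (rule Bochner_Integration.integral_sum) (simp add: sqint_mult_integrable[OF f e])
    also have "\<dots> = c * (\<Sum>i<n. (a i)\<^sup>2)"
      using \<open>c > 0\<close> unfolding sum_distrib_left
      by (intro sum.cong refl) (simp add: a power2_eq_square)
    finally show ?thesis .
  qed
  have "0 \<le> (\<integral>x. (f x - s x)\<^sup>2 \<partial>M)" by simp
  also have "(\<lambda>x. (f x - s x)\<^sup>2) = (\<lambda>x. (f x)\<^sup>2 - 2 * (f x * s x) + (s x)\<^sup>2)"
    by (auto simp: power2_eq_square algebra_simps)
  also have "(\<integral>x. (f x)\<^sup>2 - 2 * (f x * s x) + (s x)\<^sup>2 \<partial>M) = (\<integral>x. (f x)\<^sup>2 \<partial>M) - c * (\<Sum>i<n. (a i)\<^sup>2)"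
    using sqint_mult_integrable[OF f s] s f s2 fs by (simp add: sqint_def)
  finally show "(\<Sum>i<n. (a i)\<^sup>2) \<le> (\<integral>x. (f x)\<^sup>2 \<partial>M) / c"
    using \<open>c > 0\<close> by (simp add: field_simps)
qed simp

section \<open>Lebesgue and Henstock--Kurzweil integrals on boxes\<close>

lemma integrable_lebesgue_on_iff:
  fixes f :: "'a::euclidean_space \<Rightarrow> real"
  assumes "S \<in> sets lebesgue"
  shows "integrable (lebesgue_on S) f \<longleftrightarrow> f absolutely_integrable_on S"
  using assms by (simp add: set_integrable_def integrable_restrict_space)

lemma L2_on_iff_sqint:
  assumes "S \<in> sets lebesgue"
  shows "L2_on S f \<longleftrightarrow> sqint (lebesgue_on S) f"
  unfolding L2_on_def sqint_def
  using assms by (simp add: measurable_on_iff_borel_measurable integrable_lebesgue_on_iff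
      absolutely_integrable_on_iff_nonneg)

lemma L2_on_mult:
  assumes "S \<in> sets lebesgue" "L2_on S f" "L2_on S g"
  shows "(\<lambda>x. f x * g x) absolutely_integrable_on S"
    and "integral S (\<lambda>x. f x * g x) = (\<integral>x. f x * g x \<partial>lebesgue_on S)"
proof -
  have *: "integrable (lebesgue_on S) (\<lambda>x. f x * g x)"
    using assms by (intro sqint_mult_integrable) (auto simp: L2_on_iff_sqint)
  then show "(\<lambda>x. f x * g x) absolutely_integrable_on S"
    using assms integrable_lebesgue_on_iff by blast
  show "integral S (\<lambda>x. f x * g x) = (\<integral>x. f x * g x \<partial>lebesgue_on S)"
    using lebesgue_integral_eq_integral[OF * assms(1)] by simp
qed

lemma L2_on_integrable:
  assumes "S \<in> sets lebesgue" "L2_on S f" "L2_on S g"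
  shows "(\<lambda>x. f x * g x) integrable_on S"
  using L2_on_mult(1)[OF assms] by (simp add: absolutely_integrable_on_def)

lemma L2_on_add: "S \<in> sets lebesgue \<Longrightarrow> L2_on S f \<Longrightarrow> L2_on S g \<Longrightarrow> L2_on S (\<lambda>x. f x + g x)"
  by (simp add: L2_on_iff_sqint sqint_add)

lemma L2_on_diff: "S \<in> sets lebesgue \<Longrightarrow> L2_on S f \<Longrightarrow> L2_on S g \<Longrightarrow> L2_on S (\<lambda>x. f x - g x)"
  by (simp add: L2_on_iff_sqint sqint_diff)

lemma L2_on_cmult: "S \<in> sets lebesgue \<Longrightarrow> L2_on S f \<Longrightarrow> L2_on S (\<lambda>x. c * f x)"
  by (simp add: L2_on_iff_sqint sqint_cmult)

lemma L2_on_continuous: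
  fixes f :: "'a::euclidean_space \<Rightarrow> real"
  assumes "continuous_on S f" "compact S"
  shows "L2_on S f"
proof -
  have S: "S \<in> sets lebesgue" using assms(2) by (intro lmeasurable_compact fmeasurableD)
  have "integrable lborel (\<lambda>x. indicator S x *\<^sub>R (f x)\<^sup>2)"
    by (intro borel_integrable_compact continuous_intros assms)
  then have "set_integrable lborel S (\<lambda>x. (f x)\<^sup>2)"
    by (simp add: set_integrable_def)
  then have "(\<lambda>x. (f x)\<^sup>2) integrable_on S"
    by (rule set_borel_integral_eq_integral)
  then show ?thesis
    using continuous_imp_measurable_on_sets_lebesgue[OF assms(1) S] S
    by (simp add: L2_on_def measurable_on_iff_borel_measurable)
qed

lemma sets_lebesgue_box: "{a..b::real} \<in> sets lebesgue" "{a..b::real} \<times> {c..d::real} \<in> sets lebesgue"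
  by (auto intro!: lmeasurable_compact fmeasurableD compact_Times)

lemma L2_on_absolutely_integrable:
  assumes "L2_on {a..b::real} f"
  shows "f absolutely_integrable_on {a..b}"
  using L2_on_mult(1)[OF _ assms, of "\<lambda>_. 1"] L2_on_continuous[of "{a..b}" "\<lambda>_. 1"]
  by (auto simp: sets_lebesgue_box)

lemma integrable_mult_continuous:
  fixes f h :: "real \<Rightarrow> real"
  assumes f: "f absolutely_integrable_on {a..b}" and h: "continuous_on {a..b} h"
  shows "(\<lambda>x. f x * h x) integrable_on {a..b}"
proof -
  have "(\<lambda>x. h x * f x) absolutely_integrable_on {a..b}"
  proof (rule absolutely_integrable_bounded_measurable_product_real)
    show "h \<in> borel_measurable (lebesgue_on {a..b})"
      by (rule continuous_imp_measurable_on_sets_lebesgue[OF h sets_lebesgue_box(1)])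
    show "bounded (h ` {a..b})"
      by (intro compact_imp_bounded compact_continuous_image h) simp
  qed (use f sets_lebesgue_box in auto)
  then show ?thesis by (simp add: absolutely_integrable_on_def mult.commute)
qed

lemma integral_LBINT:
  fixes f :: "'a::euclidean_space \<Rightarrow> real"
  assumes "set_integrable lborel S f"
  shows "integral S f = (\<integral>x. indicator S x * f x \<partial>lborel)"
  using set_borel_integral_eq_integral(2)[OF assms] by (simp add: set_lebesgue_integral_def)

text \<open>Tonelli applies to the separated majorant \<open>G\<close>, which dominates the
  integrand on the box. Borel measurability of \<open>f\<close> keeps everything on the product of
  two copies of \<open>lborel\<close>. \<open>H\<close> may be discontinuous, so that the indicator
  of a triangle is covered.\<close>

lemma Qint_Fubini_bounded:
  fixes f :: "real \<Rightarrow> real" and H :: "real \<Rightarrow> real \<Rightarrow> real"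
  assumes f [measurable]: "f \<in> borel_measurable borel" and fi: "f absolutely_integrable_on {0..L}"
    and H [measurable]: "(\<lambda>(x,t). H x t) \<in> borel_measurable (borel \<Otimes>\<^sub>M borel)"
    and bound: "\<And>x t. x \<in> {0..L} \<Longrightarrow> t \<in> {0..T} \<Longrightarrow> \<bar>H x t\<bar> \<le> C"
  shows "Qint L T (\<lambda>x t. f x * H x t) = integral {0..L} (\<lambda>x. f x * integral {0..T} (H x))"
    and "Qint L T (\<lambda>x t. f x * H x t) = integral {0..T} (\<lambda>t. integral {0..L} (\<lambda>x. f x * H x t))"
    and "(\<lambda>(x,t). f x * H x t) absolutely_integrable_on ({0..L} \<times> {0..T})"
proof -
  define F where "F = (\<lambda>x t. indicator {0..L} x * indicator {0..T} t * (f x * H x t) :: real)"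
  define G where "G = (\<lambda>(x,t). (indicator {0..L} x * \<bar>f x\<bar>) * (indicator {0..T} t * \<bar>C\<bar>) :: real)"
  have fi': "set_integrable lborel {0..L} f"
    using fi by (simp add: set_integrable_def integrable_completion)
  have Hm [measurable]: "H x \<in> borel_measurable borel" "(\<lambda>x. H x t) \<in> borel_measurable borel" for x t
    using measurable_Pair2[OF H, of x] measurable_Pair1[OF H, of t] by auto
  have Fm: "case_prod F \<in> borel_measurable (lborel \<Otimes>\<^sub>M lborel)"
    unfolding F_def by measurable
  have absf: "integrable lborel (\<lambda>x. indicator {0..L} x * \<bar>f x\<bar>)"
    using set_integrable_abs[OF fi'] by (simp add: set_integrable_def)
  have indT: "integrable lborel (indicat_real {0..T})"
    by (rule integrable_real_indicator) (auto simp: emeasure_lborel_Icc_eq)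
  have G: "integrable (lborel \<Otimes>\<^sub>M lborel) G"
  proof (rule lborel_pair.Fubini_integrable)
    show "G \<in> borel_measurable (lborel \<Otimes>\<^sub>M lborel)" unfolding G_def by measurable
    have "(\<integral>t. norm (G (x, t)) \<partial>lborel) = indicator {0..L} x * \<bar>f x\<bar> * (\<integral>t. indicator {0..T} t * \<bar>C\<bar> \<partial>lborel)" for x
      unfolding G_def by (simp add: abs_mult)
    then show "integrable lborel (\<lambda>x. \<integral>t. norm (G (x, t)) \<partial>lborel)"
      using absf by simp
    show "AE x in lborel. integrable lborel (\<lambda>t. G (x, t))"
      using indT unfolding G_def by simp
  qed
  have Fi: "integrable (lborel \<Otimes>\<^sub>M lborel) (case_prod F)"
  proof (rule Bochner_Integration.integrable_bound[OF G Fm], rule AE_I2, clarsimp)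
    fix x t
    show "\<bar>F x t\<bar> \<le> \<bar>G (x, t)\<bar>"
    proof (cases "x \<in> {0..L} \<and> t \<in> {0..T}")
      case True
      then have "\<bar>H x t\<bar> \<le> \<bar>C\<bar>" using bound[of x t] by linarith
      then show ?thesis using True by (simp add: F_def G_def abs_mult mult_left_mono)
    qed (auto simp: F_def G_def)
  qed
  have ind: "indicator ({0..L} \<times> {0..T}) p *\<^sub>R (case p of (x,t) \<Rightarrow> f x * H x t) = case_prod F p" for p
    by (auto simp: F_def indicator_def split: prod.splits)
  have Fs: "set_integrable lborel ({0..L} \<times> {0..T}) (\<lambda>(x,t). f x * H x t)"
    using Fi unfolding set_integrable_def ind lborel_prod .
  have "(\<lambda>p. indicator ({0..L} \<times> {0..T}) p *\<^sub>R (case p of (x,t) \<Rightarrow> f x * H x t)) \<in> borel_measurable lborel"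
    using borel_measurable_integrable[OF Fs[unfolded set_integrable_def]] .
  then show "(\<lambda>(x,t). f x * H x t) absolutely_integrable_on ({0..L} \<times> {0..T})"
    using Fs unfolding set_integrable_def by (subst integrable_completion)
  have Q: "Qint L T (\<lambda>x t. f x * H x t) = integral\<^sup>L (lborel \<Otimes>\<^sub>M lborel) (case_prod F)"
    unfolding Qint_def integral_LBINT[OF Fs] lborel_prod using ind by simp
  have Ht: "set_integrable lborel {0..T} (H x)" if "x \<in> {0..L}" for x
    unfolding set_integrable_def
  proof (rule Bochner_Integration.integrable_bound)
    show "integrable lborel (\<lambda>t. indicator {0..T} t * \<bar>C\<bar>)" using indT by simp
    show "AE t in lborel. norm (indicat_real {0..T} t *\<^sub>R H x t) \<le> norm (indicat_real {0..T} t * \<bar>C\<bar>)"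
    proof (rule AE_I2)
      fix t show "norm (indicat_real {0..T} t *\<^sub>R H x t) \<le> norm (indicat_real {0..T} t * \<bar>C\<bar>)"
        using bound[of x t] that by (auto simp: indicator_def)
    qed
  qed measurable
  have Hx: "set_integrable lborel {0..L} (\<lambda>x. f x * H x t)" if "t \<in> {0..T}" for t
    unfolding set_integrable_def
  proof (rule Bochner_Integration.integrable_bound)
    show "integrable lborel (\<lambda>x. indicator {0..L} x * \<bar>f x\<bar> * \<bar>C\<bar>)" using absf by simp
    show "AE x in lborel. norm (indicat_real {0..L} x *\<^sub>R (f x * H x t)) \<le> norm (indicat_real {0..L} x * \<bar>f x\<bar> * \<bar>C\<bar>)"
    proof (rule AE_I2)
      fix x show "norm (indicat_real {0..L} x *\<^sub>R (f x * H x t)) \<le> norm (indicat_real {0..L} x * \<bar>f x\<bar> * \<bar>C\<bar>)"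
        using bound[of x t] that by (auto simp: indicator_def abs_mult intro!: mult_left_mono)
    qed
  qed measurable
  have in1: "(\<integral>t. F x t \<partial>lborel) = indicator {0..L} x * (f x * integral {0..T} (H x))" for x
  proof (cases "x \<in> {0..L}")
    case True
    have "(\<integral>t. F x t \<partial>lborel) = (\<integral>t. f x * (indicator {0..T} t * H x t) \<partial>lborel)"
      using True by (simp add: F_def ac_simps)
    then show ?thesis using True integral_LBINT[OF Ht[OF True]] by simp
  qed (simp add: F_def)
  have in2: "(\<integral>x. F x t \<partial>lborel) = indicator {0..T} t * integral {0..L} (\<lambda>x. f x * H x t)" for t
  proof (cases "t \<in> {0..T}")
    case True
    then show ?thesis using True integral_LBINT[OF Hx[OF True]] by (simp add: F_def)
  qed (simp add: F_def)
  have "set_integrable lborel {0..L} (\<lambda>x. f x * integral {0..T} (H x))"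
    using lborel_pair.integrable_fst'[OF Fi] by (simp add: set_integrable_def in1)
  from integral_LBINT[OF this] 
  show "Qint L T (\<lambda>x t. f x * H x t) = integral {0..L} (\<lambda>x. f x * integral {0..T} (H x))"
    unfolding Q using lborel_pair.integral_fst'[OF Fi] by (simp add: in1)
  have "set_integrable lborel {0..T} (\<lambda>t. integral {0..L} (\<lambda>x. f x * H x t))"
    using lborel_pair.integrable_snd[OF Fi] by (simp add: set_integrable_def in2)
  from integral_LBINT[OF this]
  show "Qint L T (\<lambda>x t. f x * H x t) = integral {0..T} (\<lambda>t. integral {0..L} (\<lambda>x. f x * H x t))"
    unfolding Q using lborel_pair.integral_snd[OF Fi] by (simp add: in2)
qed

lemma Qint_Fubini:
  fixes f :: "real \<Rightarrow> real" and H :: "real \<Rightarrow> real \<Rightarrow> real"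
  assumes f: "f \<in> borel_measurable borel" and fi: "f absolutely_integrable_on {0..L}"
    and H: "continuous_on UNIV (\<lambda>(x,t). H x t)"
  shows "Qint L T (\<lambda>x t. f x * H x t) = integral {0..L} (\<lambda>x. f x * integral {0..T} (H x))"
    and "Qint L T (\<lambda>x t. f x * H x t) = integral {0..T} (\<lambda>t. integral {0..L} (\<lambda>x. f x * H x t))"
    and "(\<lambda>(x,t). f x * H x t) absolutely_integrable_on ({0..L} \<times> {0..T})"
proof -
  have "compact ((\<lambda>(x,t). H x t) ` ({0..L} \<times> {0..T}))"
    by (intro compact_continuous_image compact_Times continuous_on_subset[OF H]) auto
  then obtain C where "\<forall>y\<in>(\<lambda>(x,t). H x t) ` ({0..L} \<times> {0..T}). norm y \<le> C"
    using compact_imp_bounded bounded_iff by blast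
  then have C: "\<And>x t. x \<in> {0..L} \<Longrightarrow> t \<in> {0..T} \<Longrightarrow> \<bar>H x t\<bar> \<le> C" by force
  have m: "(\<lambda>(x,t). H x t) \<in> borel_measurable (borel \<Otimes>\<^sub>M borel)"
    using borel_measurable_continuous_onI[OF H] by (simp add: borel_prod)
  show "Qint L T (\<lambda>x t. f x * H x t) = integral {0..L} (\<lambda>x. f x * integral {0..T} (H x))"
    "Qint L T (\<lambda>x t. f x * H x t) = integral {0..T} (\<lambda>t. integral {0..L} (\<lambda>x. f x * H x t))"
    "(\<lambda>(x,t). f x * H x t) absolutely_integrable_on ({0..L} \<times> {0..T})"
    by (rule Qint_Fubini_bounded[OF f fi m C]; assumption)+
qed

lemma L2Q_mult_continuous:
  fixes f :: "real \<Rightarrow> real" and H :: "real \<Rightarrow> real \<Rightarrow> real"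
  assumes f [measurable]: "f \<in> borel_measurable borel" and fi: "L2_on {0..L} f"
    and H: "continuous_on UNIV (\<lambda>(x,t). H x t)"
  shows "L2Q L T (\<lambda>x t. f x * H x t)"
proof -
  have "(\<lambda>x. (f x)\<^sup>2) absolutely_integrable_on {0..L}"
    using fi by (subst absolutely_integrable_on_iff_nonneg) (auto simp: L2_on_def)
  moreover have "continuous_on UNIV (\<lambda>(x,t). (H x t)\<^sup>2)"
    using continuous_on_power[OF H, of 2] by (simp add: case_prod_unfold)
  ultimately have "(\<lambda>(x,t). (f x)\<^sup>2 * (H x t)\<^sup>2) absolutely_integrable_on ({0..L} \<times> {0..T})"
    by (intro Qint_Fubini(3)) auto
  then have 1: "(\<lambda>p. ((\<lambda>(x,t). f x * H x t) p)\<^sup>2) integrable_on ({0..L} \<times> {0..T})"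
    by (simp add: absolutely_integrable_on_def power_mult_distrib case_prod_unfold)
  have [measurable]: "(\<lambda>(x,t). H x t) \<in> borel_measurable (borel \<Otimes>\<^sub>M borel)"
    using borel_measurable_continuous_onI[OF H] by (simp add: borel_prod)
  have "(\<lambda>(x,t). f x * H x t) \<in> borel_measurable (borel \<Otimes>\<^sub>M borel)" by measurable
  then have "(\<lambda>(x,t). f x * H x t) \<in> borel_measurable lebesgue"
    by (intro measurable_completion) (simp add: borel_prod)
  then have "(\<lambda>(x,t). f x * H x t) \<in> borel_measurable (lebesgue_on ({0..L} \<times> {0..T}))"
    by (rule measurable_restrict_space1)
  then show ?thesis
    using 1 by (simp add: L2Q_def L2_on_def measurable_on_iff_borel_measurable sets_lebesgue_box)
qed

section \<open>Completeness of the sine system\<close>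

text \<open>The shift by \<open>Suc\<close> leaves out the zero frequency: every frequency is
  positive, and sines and cosines alike have squared norm \<open>L / 2\<close> for all
  indices.\<close>

definition freq :: "real \<Rightarrow> nat \<Rightarrow> real" where
  "freq L n = real (Suc n) * pi / L"

lemma freq_pos: "L > 0 \<Longrightarrow> freq L n > 0"
  by (simp add: freq_def)

lemma freq_ge: "L > 0 \<Longrightarrow> freq L n \<ge> pi / L"
  by (simp add: freq_def divide_right_mono)

lemma sin_freq_L: "L > 0 \<Longrightarrow> sin (freq L n * L) = 0"
  using sin_npi[of "Suc n"] by (simp add: freq_def)

lemma integral_cos_period:
  assumes "L > 0"
  shows "integral {0..L} (\<lambda>x. cos (of_int k * pi / L * x)) = (if k = 0 then L else 0)"
proof (cases "k = 0")
  case True then show ?thesis using assms by simp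
next
  case False
  define c where "c = of_int k * pi / L"
  have c: "c \<noteq> 0" using False assms by (simp add: c_def)
  have "((\<lambda>x. cos (c * x)) has_integral (sin (c * L) / c - sin (c * 0) / c)) {0..L}"
    using assms c
    by (intro fundamental_theorem_of_calculus)
      (auto intro!: derivative_eq_intros simp flip: has_real_derivative_iff_has_vector_derivative)
  moreover have "sin (c * L) = 0"
    using assms sin_npi_int[of k] by (simp add: c_def mult.commute)
  ultimately have "integral {0..L} (\<lambda>x. cos (c * x)) = 0"
    by (simp add: integral_unique)
  then show ?thesis using False by (simp add: c_def)
qed

lemma freq_diff: "freq L m * x - freq L n * x = of_int (int m - int n) * pi / L * x"
  by (simp add: freq_def algebra_simps add_divide_distrib diff_divide_distrib)

text \<open>The two index shifts add up to the 2, so the integer is positive and this half of the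
  product formula always integrates to zero.\<close>

lemma freq_sum: "freq L m * x + freq L n * x = of_int (int m + int n + 2) * pi / L * x"
  by (simp add: freq_def algebra_simps add_divide_distrib diff_divide_distrib)

lemma
  assumes "L > 0"
  shows integral_sin_sin: "integral {0..L} (\<lambda>x. sin (freq L m * x) * sin (freq L n * x)) = (if m = n then L / 2 else 0)"
    and integral_cos_cos: "integral {0..L} (\<lambda>x. cos (freq L m * x) * cos (freq L n * x)) = (if m = n then L / 2 else 0)"
proof -
  have i1: "integral {0..L} (\<lambda>x. cos (freq L m * x - freq L n * x)) = (if m = n then L else 0)"
    unfolding freq_diff integral_cos_period[OF assms] by simp
  have i2: "integral {0..L} (\<lambda>x. cos (freq L m * x + freq L n * x)) = 0"
    unfolding freq_sum integral_cos_period[OF assms] by auto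
  have c1: "(\<lambda>x. cos (freq L m * x - freq L n * x)) integrable_on {0..L}"
    and c2: "(\<lambda>x. cos (freq L m * x + freq L n * x)) integrable_on {0..L}"
    by (intro integrable_continuous_interval continuous_intros)+
  show "integral {0..L} (\<lambda>x. sin (freq L m * x) * sin (freq L n * x)) = (if m = n then L / 2 else 0)"
    unfolding sin_times_sin integral_divide integral_diff[OF c1 c2] i1 i2 by simp
  show "integral {0..L} (\<lambda>x. cos (freq L m * x) * cos (freq L n * x)) = (if m = n then L / 2 else 0)"
    unfolding cos_times_cos integral_divide integral_add[OF c1 c2] i1 i2 by simp
qed

text \<open>A factor \<open>cos (pi / L * x)\<close> replaces the sine of index \<open>n\<close> by
  the mean of its two neighbours, so induction on \<open>k\<close> works once \<open>n\<close> is
  arbitrary. For \<open>n = 0\<close> the sine vanishes identically.\<close>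

lemma orthogonal_sines_trig_poly:
  assumes L: "L > 0" and D: "L2_on {0..L} D"
    and orth: "\<And>n. integral {0..L} (\<lambda>x. D x * sin (freq L n * x)) = 0"
  shows "integral {0..L} (\<lambda>x. D x * (sin (real n * pi / L * x) * cos (pi / L * x) ^ k)) = 0"
proof (induction k arbitrary: n)
  case 0
  show ?case
  proof (cases n)
    case (Suc j) then show ?thesis using orth[of j] by (simp add: freq_def)
  qed simp
next
  case (Suc k)
  have I: "(\<lambda>x. D x * (sin (real j * pi / L * x) * cos (pi / L * x) ^ k)) integrable_on {0..L}" for j
    by (intro L2_on_integrable D sets_lebesgue_box L2_on_continuous continuous_intros) auto
  show ?case
  proof (cases n)
    case (Suc j)
    have "sin (real n * pi / L * x) * cos (pi / L * x) = (sin (real (Suc n) * pi / L * x) + sin (real j * pi / L * x)) / 2" for x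
    proof -
      have "real n * pi / L * x + pi / L * x = real (Suc n) * pi / L * x"
        "real n * pi / L * x - pi / L * x = real j * pi / L * x"
        using Suc by (simp_all add: algebra_simps add_divide_distrib)
      then show ?thesis unfolding sin_times_cos by simp
    qed
    then have "D x * ((sin (real n * pi / L * x) * cos (pi / L * x)) * cos (pi / L * x) ^ k) =
       (D x * (sin (real (Suc n) * pi / L * x) * cos (pi / L * x) ^ k)
       + D x * (sin (real j * pi / L * x) * cos (pi / L * x) ^ k)) / 2" for x
      by (simp only: distrib_left distrib_right add_divide_distrib times_divide_eq_left times_divide_eq_right)
    then have "D x * (sin (real n * pi / L * x) * cos (pi / L * x) ^ Suc k) =
       (D x * (sin (real (Suc n) * pi / L * x) * cos (pi / L * x) ^ k)
       + D x * (sin (real j * pi / L * x) * cos (pi / L * x) ^ k)) / 2" for x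
      by (simp only: power_Suc mult.assoc)
    then have "integral {0..L} (\<lambda>x. D x * (sin (real n * pi / L * x) * cos (pi / L * x) ^ Suc k))
       = (integral {0..L} (\<lambda>x. D x * (sin (real (Suc n) * pi / L * x) * cos (pi / L * x) ^ k))
        + integral {0..L} (\<lambda>x. D x * (sin (real j * pi / L * x) * cos (pi / L * x) ^ k))) / 2"
      by (simp only: integral_divide integral_add[OF I I])
    then show ?thesis by (simp only: Suc.IH) simp
  qed simp
qed

text \<open>The substitution \<open>y = cos (pi / L * x)\<close> is a bijection from the interval to
  \<open>[-1, 1]\<close>, so Weierstrass approximates \<open>F\<close> uniformly by polynomials in
  this cosine. The extra sine factor turns each of their monomials into an integrand of the previous
  lemma with \<open>n = 1\<close>.\<close>

lemma sine_system_complete_sin: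
  assumes L: "L > 0" and D: "L2_on {0..L} D"
    and orth: "\<And>n. integral {0..L} (\<lambda>x. D x * sin (freq L n * x)) = 0"
    and F: "continuous_on {0..L} F"
  shows "integral {0..L} (\<lambda>x. D x * (sin (pi / L * x) * F x)) = 0"
proof -
  let ?s = "\<lambda>x. sin (pi / L * x)"
  have Di: "(\<lambda>x. D x * h x) integrable_on {0..L}" if "continuous_on {0..L} h" for h
    by (intro L2_on_integrable D sets_lebesgue_box L2_on_continuous that) auto
  have absD: "(\<lambda>x. \<bar>D x\<bar>) integrable_on {0..L}"
    using L2_on_absolutely_integrable[OF D] by (simp add: absolutely_integrable_on_def)
  define K where "K = integral {0..L} (\<lambda>x. \<bar>D x\<bar>)"
  have "K \<ge> 0" unfolding K_def by (intro integral_nonneg absD) auto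
  have "\<bar>integral {0..L} (\<lambda>x. D x * (?s x * F x))\<bar> \<le> e" if "e > 0" for e
  proof -
    \<comment> \<open>The \<open>+ 1\<close> keeps the quotient meaningful when \<open>D\<close> has
      zero \<open>L1\<close> norm.\<close>
    define d where "d = e / (K + 1)"
    have "d > 0" using that \<open>K \<ge> 0\<close> by (simp add: d_def)
    have cont: "continuous_on {-1..1} (\<lambda>y. F (L / pi * arccos y))"
    proof (rule continuous_on_compose2[OF F])
      show "continuous_on {-1..1} (\<lambda>y. L / pi * arccos y)"
        by (intro continuous_intros) auto
      have "L * arccos y \<le> L * pi" "0 \<le> arccos y" if "-1 \<le> y" "y \<le> 1" for y
        using that L arccos_lbound arccos_ubound by (auto intro!: mult_left_mono)
      then show "(\<lambda>y. L / pi * arccos y) ` {-1..1} \<subseteq> {0..L}"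
        using L by (auto simp: field_simps)
    qed
    from Stone_Weierstrass_real_polynomial_function[OF compact_Icc cont \<open>d > 0\<close>]
    obtain p where p: "real_polynomial_function p"
      and pd: "\<And>y. y \<in> {-1..1} \<Longrightarrow> \<bar>F (L / pi * arccos y) - p y\<bar> < d" by blast
    from p obtain a N where pa: "p = (\<lambda>x. \<Sum>i\<le>N. a i * x ^ i)"
      using real_polynomial_function_iff_sum by blast
    let ?p = "\<lambda>x. p (cos (pi / L * x))"
    have close: "\<bar>F x - ?p x\<bar> < d" if "x \<in> {0..L}" for x
    proof -
      have "arccos (cos (pi / L * x)) = pi / L * x"
        using that L by (intro arccos_cos) (auto simp: field_simps)
      then show ?thesis using pd[of "cos (pi / L * x)"] L by simp
    qed
    have pc: "continuous_on {0..L} ?p" unfolding pa by (intro continuous_intros)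
    have "integral {0..L} (\<lambda>x. D x * (?s x * ?p x)) =
        integral {0..L} (\<lambda>x. \<Sum>i\<le>N. a i * (D x * (?s x * cos (pi / L * x) ^ i)))"
      by (simp add: pa sum_distrib_left ac_simps)
    also have "\<dots> = (\<Sum>i\<le>N. integral {0..L} (\<lambda>x. a i * (D x * (?s x * cos (pi / L * x) ^ i))))"
      by (intro integral_sum integrable_on_mult_right Di continuous_intros) auto
    also have "\<dots> = 0"
      using orthogonal_sines_trig_poly[OF L D orth, of 1] by simp
    finally have p0: "integral {0..L} (\<lambda>x. D x * (?s x * ?p x)) = 0" .
    have "integral {0..L} (\<lambda>x. D x * (?s x * F x)) =
        integral {0..L} (\<lambda>x. D x * (?s x * F x)) - integral {0..L} (\<lambda>x. D x * (?s x * ?p x))"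
      using p0 by simp
    also have "\<dots> = integral {0..L} (\<lambda>x. D x * (?s x * F x) - D x * (?s x * ?p x))"
      by (intro integral_diff[symmetric] Di continuous_intros F pc)
    also have "norm \<dots> \<le> integral {0..L} (\<lambda>x. \<bar>D x\<bar> * d)"
    proof (rule integral_norm_bound_integral)
      show "(\<lambda>x. D x * (?s x * F x) - D x * (?s x * ?p x)) integrable_on {0..L}"
        by (intro integrable_diff Di continuous_intros F pc)
      show "(\<lambda>x. \<bar>D x\<bar> * d) integrable_on {0..L}"
        by (intro integrable_on_mult_left absD)
      fix x assume x: "x \<in> {0..L}"
      have "D x * (?s x * F x) - D x * (?s x * ?p x) = D x * (?s x * (F x - ?p x))"
        by (simp add: algebra_simps)
      also have "norm \<dots> \<le> \<bar>D x\<bar> * (1 * d)"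
        unfolding real_norm_def abs_mult using close[OF x]
        by (intro mult_left_mono mult_mono) auto
      finally show "norm (D x * (?s x * F x) - D x * (?s x * ?p x)) \<le> \<bar>D x\<bar> * d" by simp
    qed
    also have "\<dots> = K * d" by (simp add: K_def)
    also have "\<dots> \<le> e"
      using \<open>K \<ge> 0\<close> that by (simp add: d_def field_simps)
    finally show ?thesis by simp
  qed
  then have "\<bar>integral {0..L} (\<lambda>x. D x * (?s x * F x))\<bar> \<le> 0"
    by (rule field_le_epsilon) simp
  then show ?thesis by simp
qed

text \<open>The sine factor is divided out by regularisation: with \<open>s\<close> the first sine,
  \<open>s^2 / (s^2 + 1 / (k + 1))\<close> is at most 1 and tends to 1 wherever \<open>s\<close> is
  nonzero, so dominated convergence with majorant \<open>\<bar>D * F\<bar>\<close> removes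
  it.\<close>

theorem sine_system_complete:
  assumes L: "L > 0" and D: "L2_on {0..L} D"
    and orth: "\<And>n. integral {0..L} (\<lambda>x. D x * sin (freq L n * x)) = 0"
    and F: "continuous_on {0..L} F"
  shows "integral {0..L} (\<lambda>x. D x * F x) = 0"
proof -
  let ?s = "\<lambda>x. sin (pi / L * x)"
  \<comment> \<open>The first sine vanishes at the endpoints, so pointwise convergence is claimed
    only on the open interval, which carries the same integrals.\<close>
  define S where "S = {0<..<L}"
  have S: "integral S h = integral {0..L} h" for h :: "real \<Rightarrow> real"
    unfolding S_def using integral_open_interval_real[of 0 L h] by simp
  have Sint: "h integrable_on S \<longleftrightarrow> h integrable_on {0..L}" for h :: "real \<Rightarrow> real"
    unfolding S_def using integrable_on_open_interval_real[of h 0 L] by simp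
  have spos: "?s x > 0" if "x \<in> S" for x
    using that L by (intro sin_gt_zero) (auto simp: S_def field_simps)
  define Fk where "Fk k x = D x * (?s x * (F x * (?s x / ((?s x)\<^sup>2 + 1 / real (Suc k)))))" for k x
  have nz: "(?s x)\<^sup>2 + 1 / real (Suc k) > 0" for k x
    by (intro add_nonneg_pos) auto
  have ck: "continuous_on {0..L} (\<lambda>x. F x * (?s x / ((?s x)\<^sup>2 + 1 / real (Suc k))))" for k
    by (intro continuous_intros F ballI less_imp_neq[OF nz, symmetric])
  have zero: "integral S (Fk k) = 0" for k
    unfolding S Fk_def by (rule sine_system_complete_sin[OF L D orth ck])
  have "(\<lambda>k. integral S (Fk k)) \<longlonglongrightarrow> integral S (\<lambda>x. D x * F x)"
  proof (rule dominated_convergence(2))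
    show "Fk k integrable_on S" for k
      unfolding Sint Fk_def
      by (rule L2_on_integrable[OF sets_lebesgue_box(1) D
            L2_on_continuous[OF continuous_on_mult[OF _ ck] compact_Icc]])
        (intro continuous_intros)
    show "(\<lambda>x. \<bar>D x * F x\<bar>) integrable_on S"
      unfolding Sint using L2_on_mult(1)[OF sets_lebesgue_box(1) D L2_on_continuous[OF F]]
      by (simp add: absolutely_integrable_on_def)
    have q: "?s x * (F x * (?s x / ((?s x)\<^sup>2 + 1 / real (Suc k)))) = F x * ((?s x)\<^sup>2 / ((?s x)\<^sup>2 + 1 / real (Suc k)))" for x k
      by (simp add: power2_eq_square)
    show "norm (Fk k x) \<le> \<bar>D x * F x\<bar>" for k x
    proof -
      have "(?s x)\<^sup>2 / ((?s x)\<^sup>2 + 1 / real (Suc k)) \<le> 1"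
        using nz[of x k] by (simp add: divide_le_eq_1)
      then have "\<bar>D x * F x\<bar> * ((?s x)\<^sup>2 / ((?s x)\<^sup>2 + 1 / real (Suc k))) \<le> \<bar>D x * F x\<bar>"
        by (intro mult_left_le) auto
      then show ?thesis
        unfolding Fk_def q using nz[of x k] by (simp add: abs_mult abs_divide del: of_nat_Suc)
    qed
    fix x assume "x \<in> S"
    have "(\<lambda>k. D x * (F x * ((?s x)\<^sup>2 / ((?s x)\<^sup>2 + 1 / real (Suc k))))) \<longlonglongrightarrow> D x * (F x * ((?s x)\<^sup>2 / ((?s x)\<^sup>2 + 0)))"
      using spos[OF \<open>x \<in> S\<close>] LIMSEQ_inverse_real_of_nat[unfolded inverse_eq_divide]
      by (intro tendsto_intros) auto
    then show "(\<lambda>k. Fk k x) \<longlonglongrightarrow> D x * F x"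
      unfolding Fk_def q using spos[OF \<open>x \<in> S\<close>] by simp
  qed
  then have "integral S (\<lambda>x. D x * F x) = 0"
    unfolding zero using LIMSEQ_unique tendsto_const by blast
  then show ?thesis unfolding S .
qed

text \<open>Bessel makes the coefficients square summable, so the series has some \<open>L2\<close>
  sum \<open>w\<close>. The difference \<open>u - w\<close> is orthogonal to all sines, and
  completeness makes \<open>u\<close> and \<open>w\<close> indistinguishable by continuous
  functions.\<close>

theorem sine_series:
  assumes L: "L > 0" and u: "L2_on {0..L} u"
    and a: "\<And>n. a n = 2 / L * integral {0..L} (\<lambda>x. u x * sin (freq L n * x))"
  shows "summable (\<lambda>n. (a n)\<^sup>2)"
    and "\<And>F. continuous_on {0..L} F \<Longrightarrow>
      (\<lambda>n. a n * integral {0..L} (\<lambda>x. sin (freq L n * x) * F x)) sums integral {0..L} (\<lambda>x. u x * F x)"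
proof -
  let ?M = "lebesgue_on {0..L}"
  let ?e = "\<lambda>n x. sin (freq L n * x)"
  note sq = L2_on_iff_sqint[OF sets_lebesgue_box(1), of 0 L]
  note int = L2_on_mult(2)[OF sets_lebesgue_box(1), of 0 L, symmetric]
  have e2: "L2_on {0..L} (?e n)" for n by (intro L2_on_continuous continuous_intros) auto
  have e: "sqint ?M (?e n)" for n using e2 sq by blast
  have ee: "(\<integral>x. ?e m x * ?e n x \<partial>?M) = (if m = n then L / 2 else 0)" for m n
    unfolding int[OF e2 e2] integral_sin_sin[OF L] ..
  have u': "sqint ?M u" using u sq by blast
  show sm: "summable (\<lambda>n. (a n)\<^sup>2)"
  proof (rule Bessel_inequality_summable[OF e u'])
    show "(\<integral>x. (?e n x)\<^sup>2 \<partial>?M) = L / 2" for n using ee[of n n] by (simp add: power2_eq_square)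
    show "a n = (\<integral>x. u x * ?e n x \<partial>?M) / (L / 2)" for n
      unfolding a int[OF u e2] by simp
  qed (use L ee in auto)
  have ae: "sqint ?M (\<lambda>x. a n * ?e n x)" for n by (intro sqint_cmult e)
  have aemul: "(\<integral>x. (a m * ?e m x) * \<psi> x \<partial>?M) = a m * (\<integral>x. ?e m x * \<psi> x \<partial>?M)" for m \<psi>
    by (simp add: mult.assoc)
  have aee: "(\<integral>x. (a m * ?e m x) * (a n * ?e n x) \<partial>?M) = (if m = n then (a n)\<^sup>2 * (L / 2) else 0)" for m n
  proof -
    have "(\<integral>x. (a m * ?e m x) * (a n * ?e n x) \<partial>?M) = (\<integral>x. (a m * a n) * (?e m x * ?e n x) \<partial>?M)"
      by (simp add: ac_simps)
    also have "\<dots> = a m * a n * (\<integral>x. ?e m x * ?e n x \<partial>?M)" by simp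
    finally show ?thesis by (simp add: ee power2_eq_square)
  qed
  obtain w where w: "sqint ?M w"
    and sums: "\<And>\<psi>. sqint ?M \<psi> \<Longrightarrow> (\<lambda>n. \<integral>x. (a n * ?e n x) * \<psi> x \<partial>?M) sums (\<integral>x. w x * \<psi> x \<partial>?M)"
  proof (rule orthogonal_series_L2[OF ae])
    show "summable (\<lambda>n. \<integral>x. (a n * ?e n x)\<^sup>2 \<partial>?M)"
      using aee summable_mult2[OF sm, of "L / 2"] by (simp add: power2_eq_square)
  qed (use aee in auto)
  have w2: "L2_on {0..L} w" using w sq by blast
  \<comment> \<open>Paired with one fixed sine, the series for \<open>w\<close> has a single nonzero
    term, so \<open>w\<close> has the same coefficients as \<open>u\<close>.\<close>
  have "integral {0..L} (\<lambda>x. (u x - w x) * ?e m x) = 0" for m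
  proof -
    have "(\<lambda>n. if n = m then a n * (L / 2) else 0) sums (\<integral>x. w x * ?e m x \<partial>?M)"
      using sums[OF e[of m]] unfolding aemul ee by (simp add: if_distrib cong: if_cong)
    then have "integral {0..L} (\<lambda>x. w x * ?e m x) = a m * (L / 2)"
      unfolding int[OF w2 e2] using sums_single[of m "\<lambda>n. a n * (L / 2)"] sums_unique2 by blast
    moreover have "integral {0..L} (\<lambda>x. u x * ?e m x) = a m * (L / 2)" using L by (simp add: a)
    ultimately show ?thesis
      unfolding left_diff_distrib
      by (subst integral_diff) (auto intro!: L2_on_integrable u w2 e2 sets_lebesgue_box)
  qed
  note compl = sine_system_complete[OF L L2_on_diff[OF sets_lebesgue_box(1) u w2] this]
  show "(\<lambda>n. a n * integral {0..L} (\<lambda>x. ?e n x * F x)) sums integral {0..L} (\<lambda>x. u x * F x)"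
    if F: "continuous_on {0..L} F" for F
  proof -
    have F2: "L2_on {0..L} F" by (intro L2_on_continuous F) auto
    have "integral {0..L} (\<lambda>x. u x * F x) = integral {0..L} (\<lambda>x. w x * F x)"
      using compl[OF F] unfolding left_diff_distrib
      by (subst (asm) integral_diff) (auto intro!: L2_on_integrable u w2 F2 sets_lebesgue_box)
    then show ?thesis
      using sums[of F] F2 unfolding sq aemul by (simp add: int w2 e2 F2[unfolded sq] int[OF e2 F2] int[OF w2 F2])
  qed
qed

section \<open>Integration by parts and separated series on the space-time cylinder\<close>

lemma C1_2_derivs:
  assumes "C1_2 \<phi>"
  shows "((\<lambda>y. \<phi> y t) has_real_derivative dx \<phi> x t) (at x)"
    and "((\<lambda>s. \<phi> x s) has_real_derivative dt \<phi> x t) (at t)"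
  using assms by (auto simp: C1_2_def dx_def dt_def DERIV_deriv_iff_real_differentiable)

lemma C1_2_continuous:
  assumes "C1_2 \<phi>"
  shows "continuous_on UNIV (\<lambda>(x,t). \<phi> x t)" "continuous_on UNIV (\<lambda>(x,t). dx \<phi> x t)"
    "continuous_on UNIV (\<lambda>(x,t). dt \<phi> x t)"
  using assms by (auto simp: C1_2_def)

lemma continuous_section:
  fixes H :: "real \<Rightarrow> real \<Rightarrow> real"
  assumes "continuous_on UNIV (\<lambda>(x,t). H x t)"
  shows "continuous_on A (H x)" "continuous_on A (\<lambda>x. H x t)"
  using continuous_on_compose2[OF assms, of A "\<lambda>t. (x, t)"]
    continuous_on_compose2[OF assms, of A "\<lambda>x. (x, t)"]
  by (simp_all add: continuous_on_Pair)

lemma continuous_mult_fst: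
  fixes H :: "real \<Rightarrow> real \<Rightarrow> real"
  assumes "continuous_on UNIV (\<lambda>(x,t). H x t)" "continuous_on UNIV f"
  shows "continuous_on UNIV (\<lambda>(x,t). f x * H x t)"
  using assms(1) continuous_on_compose2[OF assms(2) continuous_on_fst[OF continuous_on_id], of UNIV]
  unfolding case_prod_unfold by (auto intro!: continuous_on_mult)

lemma continuous_mult_snd:
  fixes H :: "real \<Rightarrow> real \<Rightarrow> real"
  assumes "continuous_on UNIV (\<lambda>(x,t). H x t)" "continuous_on UNIV k"
  shows "continuous_on UNIV (\<lambda>(x,t). k t * H x t)"
  using assms(1) continuous_on_compose2[OF assms(2) continuous_on_snd[OF continuous_on_id], of UNIV]
  unfolding case_prod_unfold by (auto intro!: continuous_on_mult)

lemma integral_by_parts_interval: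
  fixes F G f g :: "real \<Rightarrow> real"
  assumes "a \<le> b"
    and F: "\<And>x. (F has_real_derivative f x) (at x)" and G: "\<And>x. (G has_real_derivative g x) (at x)"
    and f: "continuous_on {a..b} f" and g: "continuous_on {a..b} g"
  shows "integral {a..b} (\<lambda>x. F x * g x) = F b * G b - F a * G a - integral {a..b} (\<lambda>x. f x * G x)"
proof -
  have cF: "continuous_on {a..b} F" and cG: "continuous_on {a..b} G"
    using F G by (meson DERIV_continuous_on has_field_derivative_at_within)+
  have "((\<lambda>x. F x * g x + f x * G x) has_integral (F b * G b - F a * G a)) {a..b}"
  proof (rule fundamental_theorem_of_calculus[OF \<open>a \<le> b\<close>])
    fix x show "((\<lambda>x. F x * G x) has_vector_derivative (F x * g x + f x * G x)) (at x within {a..b})"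
      unfolding has_real_derivative_iff_has_vector_derivative[symmetric]
      using DERIV_mult'[OF F G, of x] by (rule has_field_derivative_at_within)
  qed
  then have "integral {a..b} (\<lambda>x. F x * g x + f x * G x) = F b * G b - F a * G a"
    by (rule integral_unique)
  moreover have "(\<lambda>x. F x * g x) integrable_on {a..b}" "(\<lambda>x. f x * G x) integrable_on {a..b}"
    by (intro integrable_continuous_interval continuous_intros cF cG f g)+
  ultimately show ?thesis
    by (simp add: integral_add)
qed

lemma L2Q_continuous:
  assumes "continuous_on UNIV (\<lambda>(x,t). H x t)"
  shows "L2Q L T H"
  unfolding L2Q_def
  by (intro L2_on_continuous compact_Times continuous_on_subset[OF assms]) auto

lemma Qint_eq_lebesgue:
  assumes "L2Q L T f" "L2Q L T g"
  shows "Qint L T (\<lambda>x t. f x t * g x t) =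
    (\<integral>p. (case p of (x,t) \<Rightarrow> f x t) * (case p of (x,t) \<Rightarrow> g x t) \<partial>lebesgue_on ({0..L} \<times> {0..T}))"
  using L2_on_mult(2)[OF sets_lebesgue_box(2) assms[unfolded L2Q_def]]
  by (simp add: Qint_def case_prod_unfold)

lemma Qint_L2_continuous_integrable:
  assumes "L2Q L T f" "continuous_on UNIV (\<lambda>(x,t). H x t)"
  shows "(\<lambda>(x,t). f x t * H x t) integrable_on ({0..L} \<times> {0..T})"
  using L2_on_integrable[OF sets_lebesgue_box(2) assms(1)[unfolded L2Q_def]
      L2Q_continuous[OF assms(2), unfolded L2Q_def]]
  by (simp add: case_prod_unfold)

lemma Qint_add:
  assumes "(\<lambda>(x,t). f x t) integrable_on ({0..L} \<times> {0..T})"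
    "(\<lambda>(x,t). g x t) integrable_on ({0..L} \<times> {0..T})"
  shows "Qint L T (\<lambda>x t. f x t + g x t) = Qint L T f + Qint L T g"
  using integral_add[OF assms] by (simp add: Qint_def case_prod_unfold)

lemma Qint_cmult: "Qint L T (\<lambda>x t. c * f x t) = c * Qint L T f"
  by (simp add: Qint_def case_prod_unfold)

text \<open>Orthogonality in \<open>x\<close> alone makes the products orthogonal on the rectangle,
  whatever the time factors are. A bound on their energies that is uniform in \<open>n\<close> then
  reduces convergence to square summability of \<open>a\<close>.\<close>

lemma separated_series_L2:
  fixes e k :: "nat \<Rightarrow> real \<Rightarrow> real"
  assumes e: "\<And>n. continuous_on UNIV (e n)" and k: "\<And>n. continuous_on UNIV (k n)"
    and ee: "\<And>m n. integral {0..L} (\<lambda>x. e m x * e n x) = (if m = n then c else 0)"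
    and K: "\<And>n. integral {0..T} (\<lambda>t. (k n t)\<^sup>2) \<le> K" and a: "summable (\<lambda>n. (a n)\<^sup>2)"
  obtains w where "L2Q L T w"
    "\<And>\<psi>. continuous_on UNIV (\<lambda>(x,t). \<psi> x t) \<Longrightarrow>
      (\<lambda>n. a n * Qint L T (\<lambda>x t. e n x * (k n t * \<psi> x t))) sums Qint L T (\<lambda>x t. w x t * \<psi> x t)"
proof -
  let ?M = "lebesgue_on ({0..L} \<times> {0..T})"
  have one: "continuous_on UNIV (\<lambda>(x::real,t::real). 1::real)" by (simp add: case_prod_unfold)
  have c0: "c \<ge> 0"
    using ee[of 0 0] integral_nonneg[of "\<lambda>x. e 0 x * e 0 x" "{0..L}"]
    by (auto intro!: integrable_continuous_interval continuous_on_mult continuous_on_subset[OF e])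
  define g where "g n = (\<lambda>x t. a n * (e n x * k n t))" for n
  have gc: "continuous_on UNIV (\<lambda>(x,t). g n x t)" for n
    unfolding g_def
    using continuous_mult_fst[OF continuous_mult_fst[OF continuous_mult_snd[OF one k[of n]] e[of n]], of "\<lambda>_. a n"]
    by simp
  have gL: "L2Q L T (g n)" for n by (rule L2Q_continuous[OF gc])
  have eborel: "e n \<in> borel_measurable borel" for n by (rule borel_measurable_continuous_onI[OF e])
  have sep: "Qint L T (\<lambda>x t. e m x * e n x * (k m t * k n t)) = 
      integral {0..L} (\<lambda>x. e m x * e n x) * integral {0..T} (\<lambda>t. k m t * k n t)" for m n
    using Qint_Fubini(1)[of "\<lambda>x. e m x * e n x" L "\<lambda>x t. k m t * k n t"]
      continuous_mult_snd[OF one continuous_on_mult[OF k[of m] k[of n]]] eborel[of m] eborel[of n]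
    by (auto intro!: absolutely_integrable_continuous_real continuous_on_mult continuous_on_subset[OF e])
  have gg: "(\<integral>p. (case p of (x,t) \<Rightarrow> g m x t) * (case p of (x,t) \<Rightarrow> g n x t) \<partial>?M) =
      (if m = n then (a n)\<^sup>2 * c * integral {0..T} (\<lambda>t. (k n t)\<^sup>2) else 0)" for m n
  proof -
    have "(\<integral>p. (case p of (x,t) \<Rightarrow> g m x t) * (case p of (x,t) \<Rightarrow> g n x t) \<partial>?M) =
        Qint L T (\<lambda>x t. (a m * a n) * (e m x * e n x * (k m t * k n t)))"
      unfolding Qint_eq_lebesgue[OF gL gL, symmetric] by (simp add: g_def ac_simps)
    also have "\<dots> = a m * a n * (integral {0..L} (\<lambda>x. e m x * e n x) * integral {0..T} (\<lambda>t. k m t * k n t))"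
      unfolding Qint_cmult sep ..
    finally show ?thesis by (simp add: ee power2_eq_square)
  qed
  have sq: "sqint ?M (\<lambda>(x,t). f x t) \<longleftrightarrow> L2Q L T f" for f
    unfolding L2Q_def L2_on_iff_sqint[OF sets_lebesgue_box(2)] ..
  obtain w' where w': "sqint ?M w'"
    and sums: "\<And>\<psi>. sqint ?M \<psi> \<Longrightarrow> (\<lambda>n. \<integral>p. (case p of (x,t) \<Rightarrow> g n x t) * \<psi> p \<partial>?M) sums (\<integral>p. w' p * \<psi> p \<partial>?M)"
  proof (rule orthogonal_series_L2[of ?M "\<lambda>n p. case p of (x,t) \<Rightarrow> g n x t"])
    show "sqint ?M (\<lambda>(x,t). g n x t)" for n using gL sq by blast
    show "summable (\<lambda>n. \<integral>p. (case p of (x,t) \<Rightarrow> g n x t)\<^sup>2 \<partial>?M)"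
    proof (rule summable_comparison_test'[OF summable_mult2[OF a, of "c * K"]])
      fix n :: nat
      have "0 \<le> integral {0..T} (\<lambda>t. (k n t)\<^sup>2)"
        by (intro integral_nonneg integrable_continuous_interval continuous_on_power continuous_on_subset[OF k]) auto
      then show "norm (\<integral>p. (case p of (x,t) \<Rightarrow> g n x t)\<^sup>2 \<partial>?M) \<le> (a n)\<^sup>2 * (c * K)"
        using mult_left_mono[OF K[of n], of "(a n)\<^sup>2 * c"] gg[of n n] c0
        by (simp add: power2_eq_square[of "case_prod _ _"] mult.assoc)
    qed
  qed (use gg in auto)
  define w where "w x t = w' (x, t)" for x t
  have ww: "(\<lambda>(x,t). w x t) = w'" by (auto simp: w_def)
  have wL: "L2Q L T w" using w' sq[of w] by (simp add: ww)
  show thesis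
  proof (rule that[OF wL])
    fix \<psi> :: "real \<Rightarrow> real \<Rightarrow> real" assume \<psi>: "continuous_on UNIV (\<lambda>(x,t). \<psi> x t)"
    have \<psi>L: "L2Q L T \<psi>" by (rule L2Q_continuous[OF \<psi>])
    have "(\<integral>p. (case p of (x,t) \<Rightarrow> g n x t) * (case p of (x,t) \<Rightarrow> \<psi> x t) \<partial>?M) =
        a n * Qint L T (\<lambda>x t. e n x * (k n t * \<psi> x t))" for n
      unfolding Qint_eq_lebesgue[OF gL \<psi>L, symmetric] Qint_cmult[symmetric] by (simp add: g_def ac_simps)
    then show "(\<lambda>n. a n * Qint L T (\<lambda>x t. e n x * (k n t * \<psi> x t))) sums Qint L T (\<lambda>x t. w x t * \<psi> x t)"
      using sums[of "\<lambda>(x,t). \<psi> x t"] \<psi>L sq[of \<psi>] Qint_eq_lebesgue[OF wL \<psi>L] by (simp add: ww)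
  qed
qed

section \<open>Steering the heat equation\<close>

text \<open>This is the cutoff \<open>(1 - t / T)^2\<close> times the integral of
  \<open>exp (- m * s)\<close> from 0 to \<open>t\<close>. The quotient by \<open>m\<close> is the
  gain that later pays for two space derivatives.\<close>

definition profile :: "real \<Rightarrow> real \<Rightarrow> real \<Rightarrow> real" where
  "profile T m t = (1 - t / T)\<^sup>2 * ((1 - exp (- m * t)) / m)"

definition profile_deriv :: "real \<Rightarrow> real \<Rightarrow> real \<Rightarrow> real" where
  "profile_deriv T m t =
    - 2 / T * (1 - t / T) * ((1 - exp (- m * t)) / m) + (1 - t / T)\<^sup>2 * exp (- m * t)"

text \<open>With \<open>chi\<close> the cutoff and \<open>y\<close> the exponential primitive,
  \<open>(chi * y)'' + m * (chi * y)'\<close> equals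
  \<open>chi'' * y + chi' * (m * y + 2 * y')\<close> because \<open>y'' + m * y' = 0\<close>. Here
  \<open>m * y + 2 * y' = 1 + exp (- m * t)\<close>, so no power of \<open>m\<close>
  survives.\<close>

definition profile_force :: "real \<Rightarrow> real \<Rightarrow> real \<Rightarrow> real" where
  "profile_force T m t =
    2 / T\<^sup>2 * ((1 - exp (- m * t)) / m) - 2 / T * (1 - t / T) * (1 + exp (- m * t))"

lemma profile_DERIV:
  assumes "T > 0" "m > 0"
  shows "(profile T m has_real_derivative profile_deriv T m t) (at t)"
    and "(profile_deriv T m has_real_derivative profile_force T m t - m * profile_deriv T m t) (at t)"
proof -
  have 1: "profile T m = (\<lambda>t. (1 - t / T)\<^sup>2 * ((1 - exp (- m * t)) / m))"
    by (auto simp: profile_def)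
  show "(profile T m has_real_derivative profile_deriv T m t) (at t)"
    unfolding 1 profile_deriv_def using assms
    by (auto intro!: derivative_eq_intros) (simp add: field_simps)
  have 2: "profile_deriv T m = (\<lambda>t. - 2 / T * (1 - t / T) * ((1 - exp (- m * t)) / m) + (1 - t / T)\<^sup>2 * exp (- m * t))"
    by (auto simp: profile_deriv_def)
  show "(profile_deriv T m has_real_derivative profile_force T m t - m * profile_deriv T m t) (at t)"
    unfolding profile_force_def unfolding 2 using assms
    by (auto intro!: derivative_eq_intros) (simp add: field_simps power2_eq_square)
qed

lemma profile_ends [simp]:
  assumes "T > 0"
  shows "profile T m 0 = 0" "profile T m T = 0" "profile_deriv T m 0 = 1" "profile_deriv T m T = 0"
  using assms by (auto simp: profile_def profile_deriv_def)

lemma continuous_profile: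
  assumes "T > 0" "m > 0"
  shows "continuous_on A (profile T m)" "continuous_on A (profile_deriv T m)"
    "continuous_on A (profile_force T m)"
  using assms unfolding profile_def[abs_def] profile_deriv_def[abs_def] profile_force_def[abs_def]
  by (auto intro!: continuous_intros)

lemma profile_bounds:
  assumes "T > 0" "m > 0" "t \<in> {0..T}"
  shows "\<bar>profile T m t\<bar> \<le> 1 / m"
    and "\<bar>profile_deriv T m t\<bar> \<le> 2 / (T * m) + exp (- m * t)"
    and "\<bar>profile_force T m t\<bar> \<le> 2 / (T\<^sup>2 * m) + 4 / T"
proof -
  define s where "s = 1 - t / T"
  define e where "e = exp (- m * t)"
  define d where "d = (1 - e) / m"
  have s: "0 \<le> s" "s \<le> 1" using assms by (auto simp: s_def)
  have e: "0 \<le> e" "e \<le> 1" using assms by (auto simp: e_def)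
  have d: "0 \<le> d" "d \<le> 1 / m" using assms e by (auto simp: d_def divide_right_mono)
  have s2: "0 \<le> s\<^sup>2" "s\<^sup>2 \<le> 1" using s by (auto simp: power_le_one)
  have "s\<^sup>2 * d \<le> 1 * (1 / m)" using s2 d by (intro mult_mono) auto
  then show "\<bar>profile T m t\<bar> \<le> 1 / m"
    unfolding profile_def s_def[symmetric] e_def[symmetric] d_def[symmetric]
    using s2 d by (simp add: abs_mult)
  have "2 / T * s * d \<le> 2 / T * 1 * (1 / m)" using s d assms by (intro mult_mono) auto
  moreover have "0 \<le> 2 / T * s * d" using s d assms by simp
  moreover have "s\<^sup>2 * e \<le> 1 * e" "0 \<le> s\<^sup>2 * e" using mult_right_mono[OF s2(2) e(1)] s2 e by auto
  ultimately show "\<bar>profile_deriv T m t\<bar> \<le> 2 / (T * m) + exp (- m * t)"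
    unfolding profile_deriv_def s_def[symmetric] e_def[symmetric] d_def[symmetric] by (simp add: abs_le_iff)
  have "2 / T\<^sup>2 * d \<le> 2 / T\<^sup>2 * (1 / m)"
    using d assms by (intro mult_left_mono) auto
  moreover have "0 \<le> 2 / T\<^sup>2 * d" using d by simp
  moreover have "2 / T * s * (1 + e) \<le> 2 / T * 1 * 2"
    using s e assms by (intro mult_mono) auto
  moreover have "0 \<le> 2 / T * s * (1 + e)" using s e assms by simp
  ultimately show "\<bar>profile_force T m t\<bar> \<le> 2 / (T\<^sup>2 * m) + 4 / T"
    unfolding profile_force_def s_def[symmetric] e_def[symmetric] d_def[symmetric] by (simp add: abs_le_iff)
qed

lemma integral_square_le_bound:
  fixes k :: "real \<Rightarrow> real"
  assumes "T > 0" "continuous_on {0..T} k" "\<And>t. t \<in> {0..T} \<Longrightarrow> \<bar>k t\<bar> \<le> C"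
  shows "integral {0..T} (\<lambda>t. (k t)\<^sup>2) \<le> T * C\<^sup>2"
proof -
  have "integral {0..T} (\<lambda>t. (k t)\<^sup>2) \<le> integral {0..T} (\<lambda>t. C\<^sup>2)"
  proof (intro integral_le integrable_continuous_interval continuous_intros assms(2))
    fix t assume "t \<in> {0..T}"
    from power_mono[OF assms(3)[OF this], of 2] show "(k t)\<^sup>2 \<le> C\<^sup>2" by simp
  qed
  then show ?thesis using assms(1) by simp
qed

text \<open>This is the energy estimate of the heat equation for one mode: the squared exponential
  integrates to at most \<open>1 / (2 * m)\<close>, which absorbs the factor \<open>m\<close>.
  Differentiating a mode in \<open>x\<close> costs a squared frequency, a multiple of
  \<open>m\<close>, so this puts the gradient of the velocity in \<open>L2\<close> for merely square
  integrable data.\<close>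

lemma integral_profile_deriv_square:
  assumes "T > 0" "m > 0"
  shows "m * integral {0..T} (\<lambda>t. (profile_deriv T m t)\<^sup>2) \<le> 8 / (T * m) + 1"
proof -
  have "((\<lambda>t. 2 * exp (- 2 * m * t)) has_integral (- exp (- 2 * m * T) / m - (- exp (- 2 * m * 0) / m))) {0..T}"
    using assms
    by (intro fundamental_theorem_of_calculus)
      (auto intro!: derivative_eq_intros simp flip: has_real_derivative_iff_has_vector_derivative)
  then have e: "integral {0..T} (\<lambda>t. 2 * exp (- 2 * m * t)) = (1 - exp (- 2 * m * T)) / m"
    by (subst integral_unique) (auto simp: diff_divide_distrib)
  have "integral {0..T} (\<lambda>t. (profile_deriv T m t)\<^sup>2) \<le> integral {0..T} (\<lambda>t. 8 / (T * m)\<^sup>2 + 2 * exp (- 2 * m * t))"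
  proof (intro integral_le integrable_continuous_interval continuous_intros continuous_profile assms)
    fix t assume t: "t \<in> {0..T}"
    let ?A = "2 / (T * m)" and ?B = "exp (- m * t)"
    have "0 \<le> ?A + ?B" using assms by simp
    then have "(profile_deriv T m t)\<^sup>2 \<le> (?A + ?B)\<^sup>2"
      using profile_bounds(2)[OF assms t] by (metis abs_le_square_iff abs_of_nonneg)
    also have "\<dots> \<le> 2 * ?A\<^sup>2 + 2 * ?B\<^sup>2"
      using sum_squares_bound[of ?A ?B] by (simp add: power2_sum)
    also have "2 * ?A\<^sup>2 = 8 / (T * m)\<^sup>2" by (simp add: power_divide)
    also have "?B\<^sup>2 = exp (- 2 * m * t)" by (simp add: power2_eq_square flip: exp_add)
    finally show "(profile_deriv T m t)\<^sup>2 \<le> 8 / (T * m)\<^sup>2 + 2 * exp (- 2 * m * t)" .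
  qed
  also have "\<dots> = T * (8 / (T * m)\<^sup>2) + (1 - exp (- 2 * m * T)) / m"
    unfolding e[symmetric] using assms
    by (subst integral_add) (auto intro!: integrable_continuous_interval continuous_intros)
  also have "\<dots> \<le> T * (8 / (T * m)\<^sup>2) + 1 / m"
    using assms by (intro add_left_mono divide_right_mono) auto
  finally have "m * integral {0..T} (\<lambda>t. (profile_deriv T m t)\<^sup>2) \<le> m * (T * (8 / (T * m)\<^sup>2) + 1 / m)"
    using assms by (intro mult_left_mono) auto
  also have "\<dots> = 8 / (T * m) + 1" using assms by (simp add: field_simps power2_eq_square)
  finally show ?thesis .
qed


section \<open>Integration by parts for separated fields against test functions on the
  cylinder\<close>

lemma Qint_parts_time:
  assumes T: "T > 0" and f: "f \<in> borel_measurable borel" "f absolutely_integrable_on {0..L}"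
    and \<phi>: "C1_2 \<phi>" and k: "\<And>t. (k has_real_derivative k' t) (at t)" and k': "continuous_on UNIV k'"
  shows "Qint L T (\<lambda>x t. f x * (k t * dt \<phi> x t)) =
    integral {0..L} (\<lambda>x. f x * (k T * \<phi> x T - k 0 * \<phi> x 0)) - Qint L T (\<lambda>x t. f x * (k' t * \<phi> x t))"
proof -
  note c = C1_2_continuous[OF \<phi>]
  have kc: "continuous_on UNIV k" using k by (meson DERIV_continuous_on has_field_derivative_at_within)
  have ft: "integral {0..T} (\<lambda>t. k t * dt \<phi> x t) = (k T * \<phi> x T - k 0 * \<phi> x 0) - integral {0..T} (\<lambda>t. k' t * \<phi> x t)" for x
    using T continuous_section(1)[OF c(3)] continuous_on_subset[OF k']
    by (intro integral_by_parts_interval k C1_2_derivs(2)[OF \<phi>]) auto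
  have c1: "continuous_on UNIV (\<lambda>(x,t). k t * dt \<phi> x t)" by (intro continuous_mult_snd c kc)
  have c2: "continuous_on UNIV (\<lambda>(x,t). k' t * \<phi> x t)" by (intro continuous_mult_snd c k')
  note fc = integrable_mult_continuous[OF f(2)]
  have ci: "continuous_on {0..L} (\<lambda>x. integral {0..T} (\<lambda>t. k' t * \<phi> x t))"
  proof -
    have "continuous_on (cbox 0 L) (\<lambda>x. integral (cbox 0 T) (\<lambda>t. k' t * \<phi> x t))"
      by (rule integral_continuous_on_param) (auto intro: continuous_on_subset[OF c2])
    then show ?thesis by simp
  qed
  have "Qint L T (\<lambda>x t. f x * (k t * dt \<phi> x t)) =
      integral {0..L} (\<lambda>x. f x * (k T * \<phi> x T - k 0 * \<phi> x 0) - f x * integral {0..T} (\<lambda>t. k' t * \<phi> x t))"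
    unfolding Qint_Fubini(1)[OF f c1] ft by (simp add: right_diff_distrib)
  also have "\<dots> = integral {0..L} (\<lambda>x. f x * (k T * \<phi> x T - k 0 * \<phi> x 0)) - integral {0..L} (\<lambda>x. f x * integral {0..T} (\<lambda>t. k' t * \<phi> x t))"
    by (intro integral_diff fc ci continuous_intros continuous_section(2)[OF c(1)])
  finally show ?thesis unfolding Qint_Fubini(1)[OF f c2] .
qed

text \<open>By Fubini only the identity on each time slice matters. Taking it as the hypothesis
  \<open>wd\<close> covers smooth modes, primitives of integrable functions and weak derivatives at
  once.\<close>

lemma Qint_parts_weak:
  assumes f: "f \<in> borel_measurable borel" "f absolutely_integrable_on {0..L}"
    and g: "g \<in> borel_measurable borel" "g absolutely_integrable_on {0..L}"
    and \<phi>: "C1_2 \<phi>" and k: "continuous_on UNIV k"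
    and wd: "\<And>t. integral {0..L} (\<lambda>x. f x * dx \<phi> x t) = - integral {0..L} (\<lambda>x. g x * \<phi> x t)"
  shows "Qint L T (\<lambda>x t. f x * (k t * dx \<phi> x t)) = - Qint L T (\<lambda>x t. g x * (k t * \<phi> x t))"
proof -
  note c = C1_2_continuous[OF \<phi>]
  have fx: "integral {0..L} (\<lambda>x. f x * (k t * dx \<phi> x t)) = - integral {0..L} (\<lambda>x. g x * (k t * \<phi> x t))" for t
    using wd[of t] by (simp add: mult.left_commute[of _ "k t"])
  show ?thesis
    unfolding Qint_Fubini(2)[OF f continuous_mult_snd[OF c(2) k]]
      Qint_Fubini(2)[OF g continuous_mult_snd[OF c(1) k]] fx by simp
qed

text \<open>The boundary hypothesis concerns the products, so it serves sines against arbitrary test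
  functions as well as cosines against test functions that vanish at the endpoints.\<close>

lemma Qint_parts_space:
  assumes L: "L \<ge> 0" and \<phi>: "C1_2 \<phi>" and k: "continuous_on UNIV k"
    and e: "\<And>x. (e has_real_derivative e' x) (at x)" and e': "continuous_on UNIV e'"
    and bd: "\<And>t. e L * \<phi> L t - e 0 * \<phi> 0 t = 0"
  shows "Qint L T (\<lambda>x t. e x * (k t * dx \<phi> x t)) = - Qint L T (\<lambda>x t. e' x * (k t * \<phi> x t))"
proof -
  note c = C1_2_continuous[OF \<phi>]
  have ec: "continuous_on UNIV e" using e by (meson DERIV_continuous_on has_field_derivative_at_within)
  have borel: "h \<in> borel_measurable borel" "h absolutely_integrable_on {0..L}" if "continuous_on UNIV h" for h :: "real \<Rightarrow> real"
    using that by (auto intro!: borel_measurable_continuous_onI absolutely_integrable_continuous_real intro: continuous_on_subset)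
  have "integral {0..L} (\<lambda>x. e x * dx \<phi> x t) = - integral {0..L} (\<lambda>x. e' x * \<phi> x t)" for t
    using L bd[of t] continuous_section(2)[OF c(2)] continuous_on_subset[OF e']
    by (subst integral_by_parts_interval[OF _ e C1_2_derivs(1)[OF \<phi>]]) auto
  then show ?thesis
    by (intro Qint_parts_weak borel ec e' \<phi> k)
qed

text \<open>The solution of the heat equation with initial value \<open>u\<close> is \<open>\<Sum> a\<^sub>n exp (- m\<^sub>n t) sin (\<omega>\<^sub>n x)\<close>
  with \<open>m\<^sub>n = \<nu> \<omega>\<^sub>n\<^sup>2\<close>. Replacing \<open>exp (- m\<^sub>n t)\<close> by \<open>q\<^sub>n = profile_deriv T m\<^sub>n\<close>, which satisfies
  \<open>q\<^sub>n(0) = 1\<close>, \<open>q\<^sub>n(T) = 0\<close> and \<open>\<integral>q\<^sub>n = 0\<close>, costs a source \<open>q\<^sub>n' + m\<^sub>n q\<^sub>n\<close> bounded in \<open>n\<close>, and steers both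
  \<open>v\<close> and the time integral \<open>r\<close> of \<open>v\<^sub>x\<close> to zero. The bound on \<open>m\<^sub>n \<integral>\<^sub>0\<^sup>t q\<^sub>n\<close> makes \<open>r\<^sub>x = -s\<close> square integrable.\<close>

theorem heat_steering:
  assumes L: "L > 0" and T: "T > 0" and \<nu>: "\<nu> > 0" and u: "L2_on {0..L} u"
  obtains v vx f r s where
    "L2Q L T v" "L2Q L T vx" "L2Q L T f" "L2Q L T r" "L2Q L T s"
    "\<And>\<phi>. C1_2 \<phi> \<Longrightarrow> Qint L T (\<lambda>x t. v x t * dx \<phi> x t) = - Qint L T (\<lambda>x t. vx x t * \<phi> x t)"
    "\<And>\<phi>. C1_2 \<phi> \<Longrightarrow> (\<forall>t. \<phi> 0 t = 0 \<and> \<phi> L t = 0) \<Longrightarrow>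
      - integral {0..L} (\<lambda>x. u x * \<phi> x 0) - Qint L T (\<lambda>x t. v x t * dt \<phi> x t)
      + \<nu> * Qint L T (\<lambda>x t. vx x t * dx \<phi> x t) = Qint L T (\<lambda>x t. f x t * \<phi> x t)"
    "\<And>\<phi>. C1_2 \<phi> \<Longrightarrow> Qint L T (\<lambda>x t. r x t * dt \<phi> x t) = - Qint L T (\<lambda>x t. vx x t * \<phi> x t)"
    "\<And>\<phi>. C1_2 \<phi> \<Longrightarrow> (\<forall>t. \<phi> 0 t = 0 \<and> \<phi> L t = 0) \<Longrightarrow>
      Qint L T (\<lambda>x t. r x t * dx \<phi> x t) = Qint L T (\<lambda>x t. s x t * \<phi> x t)"
proof -
  define w where "w = freq L"
  define m where "m n = \<nu> * (w n)\<^sup>2" for n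
  define a where "a n = 2 / L * integral {0..L} (\<lambda>x. u x * sin (w n * x))" for n
  define S where "S n x = sin (w n * x)" for n x
  define C where "C n x = cos (w n * x)" for n x
  define w0 where "w0 = pi / L"
  have w0: "w0 > 0" using L by (simp add: w0_def)
  have ww: "w n \<ge> w0" "w n > 0" for n using freq_ge[OF L] freq_pos[OF L] by (auto simp: w_def w0_def)
  have w2: "(w n)\<^sup>2 \<ge> w0\<^sup>2" for n using ww w0 by (intro power_mono) auto
  have m: "m n > 0" for n using \<nu> ww(2)[of n] by (simp add: m_def)
  \<comment> \<open>The smallest decay rate: every \<open>1 / m n\<close> below is replaced by
    \<open>1 / m0\<close>, which makes the bounds uniform in the mode.\<close>
  define m0 where "m0 = \<nu> * w0\<^sup>2"
  have m0: "m0 > 0" "m n \<ge> m0" for n using \<nu> w0 w2 by (auto simp: m_def m0_def)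
  note ser = sine_series[OF L u a_def[unfolded w_def]]
  have asum: "summable (\<lambda>n. (a n)\<^sup>2)" using ser(1) by (simp add: a_def w_def)
  have Sc: "continuous_on UNIV (S n)" "continuous_on UNIV (C n)" for n
    unfolding S_def[abs_def] C_def[abs_def] by (intro continuous_intros)+
  have SS: "integral {0..L} (\<lambda>x. S i x * S j x) = (if i = j then L / 2 else 0)"
    and CC: "integral {0..L} (\<lambda>x. C i x * C j x) = (if i = j then L / 2 else 0)" for i j
    unfolding S_def C_def w_def using integral_sin_sin[OF L] integral_cos_cos[OF L] by auto
  note pc = continuous_profile[OF T m]
  note pb = profile_bounds[OF T m]
  \<comment> \<open>\<open>K1\<close> to \<open>K5\<close> bound the time factors of
    \<open>v\<close>, \<open>vx\<close>, \<open>f\<close>, \<open>r\<close> and \<open>s\<close>, in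
    this order.\<close>
  have K1: "integral {0..T} (\<lambda>t. (profile_deriv T (m n) t)\<^sup>2) \<le> T * (2 / (T * m0) + 1)\<^sup>2" for n
  proof (intro integral_square_le_bound T pc)
    fix t assume t: "t \<in> {0..T}"
    have "2 / (T * m n) \<le> 2 / (T * m0)" using T m0 m by (intro divide_left_mono mult_left_mono) auto
    moreover have "exp (- m n * t) \<le> 1" using m[of n] t by simp
    ultimately show "\<bar>profile_deriv T (m n) t\<bar> \<le> 2 / (T * m0) + 1" using pb(2)[OF t, of n] by linarith
  qed
  have K2: "integral {0..T} (\<lambda>t. (w n * profile_deriv T (m n) t)\<^sup>2) \<le> (8 / (T * m0) + 1) / \<nu>" for n
  proof -
    have "integral {0..T} (\<lambda>t. (w n * profile_deriv T (m n) t)\<^sup>2) =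
        (m n * integral {0..T} (\<lambda>t. (profile_deriv T (m n) t)\<^sup>2)) / \<nu>"
      using \<nu> by (simp add: power_mult_distrib m_def)
    also have "\<dots> \<le> (8 / (T * m n) + 1) / \<nu>"
      using integral_profile_deriv_square[OF T m] \<nu> by (intro divide_right_mono) auto
    also have "8 / (T * m n) \<le> 8 / (T * m0)" using T m0 m by (intro divide_left_mono mult_left_mono) auto
    finally show ?thesis using \<nu> by (simp add: divide_right_mono)
  qed
  have K3: "integral {0..T} (\<lambda>t. (profile_force T (m n) t)\<^sup>2) \<le> T * (2 / (T\<^sup>2 * m0) + 4 / T)\<^sup>2" for n
  proof (intro integral_square_le_bound T pc)
    fix t assume t: "t \<in> {0..T}"
    have "2 / (T\<^sup>2 * m n) \<le> 2 / (T\<^sup>2 * m0)" using T m0 m by (intro divide_left_mono mult_left_mono) auto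
    then show "\<bar>profile_force T (m n) t\<bar> \<le> 2 / (T\<^sup>2 * m0) + 4 / T" using pb(3)[OF t, of n] by linarith
  qed
  have K4: "integral {0..T} (\<lambda>t. (w n * profile T (m n) t)\<^sup>2) \<le> T * (1 / (\<nu> * w0))\<^sup>2" for n
  proof (intro integral_square_le_bound T pc continuous_intros)
    fix t assume t: "t \<in> {0..T}"
    have "\<bar>w n * profile T (m n) t\<bar> \<le> w n * (1 / m n)"
      using pb(1)[OF t, of n] ww[of n] by (simp only: abs_mult) (intro mult_mono, auto)
    also have "\<dots> = 1 / (\<nu> * w n)" using ww[of n] \<nu> by (simp add: m_def power2_eq_square)
    also have "\<dots> \<le> 1 / (\<nu> * w0)" using \<nu> w0 ww[of n] by (intro divide_left_mono mult_left_mono) auto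
    finally show "\<bar>w n * profile T (m n) t\<bar> \<le> 1 / (\<nu> * w0)" .
  qed
  \<comment> \<open>The critical bound: two frequencies from differentiation against one
    \<open>1 / m n\<close> from the profile leave exactly \<open>1 / \<nu>\<close>.\<close>
  have K5: "integral {0..T} (\<lambda>t. (w n * (w n * profile T (m n) t))\<^sup>2) \<le> T * (1 / \<nu>)\<^sup>2" for n
  proof (intro integral_square_le_bound T pc continuous_intros)
    fix t assume t: "t \<in> {0..T}"
    have "\<bar>w n * (w n * profile T (m n) t)\<bar> \<le> w n * (w n * (1 / m n))"
      using pb(1)[OF t, of n] ww[of n] by (simp only: abs_mult) (intro mult_mono, auto)
    also have "\<dots> = 1 / \<nu>" using ww[of n] \<nu> by (simp add: m_def power2_eq_square)
    finally show "\<bar>w n * (w n * profile T (m n) t)\<bar> \<le> 1 / \<nu>" .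
  qed
  \<comment> \<open>The five limits are obtained independently of each other; their relations come
    only from equality of the tested series, term by term.\<close>
  obtain v where v: "L2Q L T v" "\<And>\<psi>. continuous_on UNIV (\<lambda>(x,t). \<psi> x t) \<Longrightarrow>
      (\<lambda>n. a n * Qint L T (\<lambda>x t. S n x * (profile_deriv T (m n) t * \<psi> x t))) sums Qint L T (\<lambda>x t. v x t * \<psi> x t)"
    by (rule separated_series_L2[where k = "\<lambda>n t. profile_deriv T (m n) t", OF Sc(1) pc(2) SS K1 asum]) blast
  obtain vx where vx: "L2Q L T vx" "\<And>\<psi>. continuous_on UNIV (\<lambda>(x,t). \<psi> x t) \<Longrightarrow>
      (\<lambda>n. a n * Qint L T (\<lambda>x t. C n x * (w n * profile_deriv T (m n) t * \<psi> x t))) sums Qint L T (\<lambda>x t. vx x t * \<psi> x t)"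
    by (rule separated_series_L2[where k = "\<lambda>n t. w n * profile_deriv T (m n) t", OF Sc(2) continuous_on_mult_left[OF pc(2)] CC K2 asum]) blast
  obtain f where f: "L2Q L T f" "\<And>\<psi>. continuous_on UNIV (\<lambda>(x,t). \<psi> x t) \<Longrightarrow>
      (\<lambda>n. a n * Qint L T (\<lambda>x t. S n x * (profile_force T (m n) t * \<psi> x t))) sums Qint L T (\<lambda>x t. f x t * \<psi> x t)"
    by (rule separated_series_L2[where k = "\<lambda>n t. profile_force T (m n) t", OF Sc(1) pc(3) SS K3 asum]) blast
  obtain r where r: "L2Q L T r" "\<And>\<psi>. continuous_on UNIV (\<lambda>(x,t). \<psi> x t) \<Longrightarrow>
      (\<lambda>n. a n * Qint L T (\<lambda>x t. C n x * (w n * profile T (m n) t * \<psi> x t))) sums Qint L T (\<lambda>x t. r x t * \<psi> x t)"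
    by (rule separated_series_L2[where k = "\<lambda>n t. w n * profile T (m n) t", OF Sc(2) continuous_on_mult_left[OF pc(1)] CC K4 asum]) blast
  obtain s where s: "L2Q L T s" "\<And>\<psi>. continuous_on UNIV (\<lambda>(x,t). \<psi> x t) \<Longrightarrow>
      (\<lambda>n. a n * Qint L T (\<lambda>x t. S n x * (w n * (w n * profile T (m n) t) * \<psi> x t))) sums Qint L T (\<lambda>x t. s x t * \<psi> x t)"
    by (rule separated_series_L2[where k = "\<lambda>n t. w n * (w n * profile T (m n) t)", OF Sc(1) continuous_on_mult_left[OF continuous_on_mult_left[OF pc(1)]] SS K5 asum]) blast
  have dS: "(S n has_real_derivative w n * C n x) (at x)" and dC: "(C n has_real_derivative - (w n * S n x)) (at x)" for n x
    unfolding S_def[abs_def] C_def[abs_def] by (auto intro!: derivative_eq_intros)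
  have S0: "S n 0 = 0" "S n L = 0" for n
    using sin_freq_L[OF L] by (auto simp: S_def w_def)
  have Sb: "S n \<in> borel_measurable borel" "S n absolutely_integrable_on {0..L}"
    "C n \<in> borel_measurable borel" "C n absolutely_integrable_on {0..L}" for n
    using Sc[of n] by (auto intro!: borel_measurable_continuous_onI absolutely_integrable_continuous_real intro: continuous_on_subset)
  have wS: "continuous_on UNIV (\<lambda>x. - (w n * S n x))" "continuous_on UNIV (\<lambda>x. w n * C n x)" for n
    by (intro continuous_intros Sc)+
  have parts_S: "Qint L T (\<lambda>x t. S n x * (k t * dx \<phi> x t)) = - Qint L T (\<lambda>x t. C n x * (w n * k t * \<phi> x t))"
    if "C1_2 \<phi>" "continuous_on UNIV k" for n k \<phi>
    using Qint_parts_space[OF less_imp_le[OF L] that dS wS(2)] S0 by (simp add: ac_simps)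
  have parts_C: "Qint L T (\<lambda>x t. C n x * (k t * dx \<phi> x t)) = Qint L T (\<lambda>x t. S n x * (w n * k t * \<phi> x t))"
    if "C1_2 \<phi>" "continuous_on UNIV k" "\<forall>t. \<phi> 0 t = 0 \<and> \<phi> L t = 0" for n k \<phi>
  proof -
    have "Qint L T (\<lambda>x t. C n x * (k t * dx \<phi> x t)) = - Qint L T (\<lambda>x t. - (w n * S n x) * (k t * \<phi> x t))"
      using that(3) by (intro Qint_parts_space[OF less_imp_le[OF L] that(1,2) dC wS(1)]) auto
    also have "\<dots> = Qint L T (\<lambda>x t. S n x * (w n * k t * \<phi> x t))"
      using Qint_cmult[of L T "-1" "\<lambda>x t. S n x * (w n * k t * \<phi> x t)"] by (simp add: ac_simps)
    finally show ?thesis .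
  qed
  note dp = profile_DERIV[OF T m]
  show thesis
  proof (rule that[OF v(1) vx(1) f(1) r(1) s(1)])
    fix \<phi> assume \<phi>: "C1_2 \<phi>"
    note c = C1_2_continuous[OF \<phi>]
    show "Qint L T (\<lambda>x t. v x t * dx \<phi> x t) = - Qint L T (\<lambda>x t. vx x t * \<phi> x t)"
      using v(2)[OF c(2)] sums_minus[OF vx(2)[OF c(1)]] unfolding parts_S[OF \<phi> pc(2)]
      by (simp add: sums_unique2)
    \<comment> \<open>The profile vanishes at both ends of the time interval, so integrating by
      parts leaves no initial or final density.\<close>
    have "Qint L T (\<lambda>x t. C n x * (w n * profile T (m n) t * dt \<phi> x t)) =
        - Qint L T (\<lambda>x t. C n x * (w n * profile_deriv T (m n) t * \<phi> x t))" for n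
      using Qint_parts_time[OF T Sb(3,4) \<phi> DERIV_cmult[OF dp(1)] continuous_on_mult_left[OF pc(2)], where c1 = "w n"] T
      by (simp add: profile_ends[OF T])
    then show "Qint L T (\<lambda>x t. r x t * dt \<phi> x t) = - Qint L T (\<lambda>x t. vx x t * \<phi> x t)"
      using r(2)[OF c(3)] sums_minus[OF vx(2)[OF c(1)]] by (simp add: sums_unique2)
    assume bd: "\<forall>t. \<phi> 0 t = 0 \<and> \<phi> L t = 0"
    show "Qint L T (\<lambda>x t. r x t * dx \<phi> x t) = Qint L T (\<lambda>x t. s x t * \<phi> x t)"
      using r(2)[OF c(2)] s(2)[OF c(1)] unfolding parts_C[OF \<phi> continuous_on_mult_left[OF pc(1)] bd]
      by (simp add: sums_unique2)
    \<comment> \<open>Parts in time give the initial term through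
      \<open>profile_deriv T m 0 = 1\<close>, nothing at \<open>T\<close>, and \<open>- m n\<close>
      times the mode. Parts in space turn the diffusion term into \<open>\<nu> * (w n)^2\<close>,
      which is \<open>m n\<close>, so the two cancel and only the force remains.\<close>
    have mode: "integral {0..L} (\<lambda>x. S n x * \<phi> x 0) = 
        - Qint L T (\<lambda>x t. S n x * (profile_deriv T (m n) t * dt \<phi> x t))
        + \<nu> * Qint L T (\<lambda>x t. C n x * (w n * profile_deriv T (m n) t * dx \<phi> x t))
        - Qint L T (\<lambda>x t. S n x * (profile_force T (m n) t * \<phi> x t))" for n
    proof -
      have i1: "(\<lambda>(x,t). S n x * (profile_force T (m n) t * \<phi> x t)) integrable_on ({0..L} \<times> {0..T})"
        and i2: "(\<lambda>(x,t). (- m n) * (S n x * (profile_deriv T (m n) t * \<phi> x t))) integrable_on ({0..L} \<times> {0..T})"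
        using Qint_Fubini(3)[where T = T, OF Sb(1,2)[of n] continuous_mult_snd[OF c(1) pc(3)[of UNIV n]]]
          Qint_Fubini(3)[where T = T, OF Sb(1,2)[of n] continuous_mult_snd[OF c(1) pc(2)[of UNIV n]]]
        by (auto simp: absolutely_integrable_on_def case_prod_unfold intro!: integrable_neg integrable_on_mult_right)
      have "Qint L T (\<lambda>x t. S n x * (profile_deriv T (m n) t * dt \<phi> x t)) =
          integral {0..L} (\<lambda>x. S n x * (- \<phi> x 0)) - Qint L T (\<lambda>x t. S n x * ((profile_force T (m n) t - m n * profile_deriv T (m n) t) * \<phi> x t))"
        using Qint_parts_time[OF T Sb(1,2) \<phi> dp(2) continuous_on_diff[OF pc(3) continuous_on_mult_left[OF pc(2)]]] T
        by (simp add: profile_ends[OF T])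
      also have "(\<lambda>x t. S n x * ((profile_force T (m n) t - m n * profile_deriv T (m n) t) * \<phi> x t)) =
         (\<lambda>x t. S n x * (profile_force T (m n) t * \<phi> x t) + (- m n) * (S n x * (profile_deriv T (m n) t * \<phi> x t)))"
        by (simp add: algebra_simps)
      also have "Qint L T \<dots> = Qint L T (\<lambda>x t. S n x * (profile_force T (m n) t * \<phi> x t))
          - m n * Qint L T (\<lambda>x t. S n x * (profile_deriv T (m n) t * \<phi> x t))"
        using Qint_add[OF i1 i2] Qint_cmult[of L T "- m n"] by simp
      finally have 1: "Qint L T (\<lambda>x t. S n x * (profile_deriv T (m n) t * dt \<phi> x t)) =
          - integral {0..L} (\<lambda>x. S n x * \<phi> x 0) - (Qint L T (\<lambda>x t. S n x * (profile_force T (m n) t * \<phi> x t))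
          - m n * Qint L T (\<lambda>x t. S n x * (profile_deriv T (m n) t * \<phi> x t)))"
        by simp
      have "\<nu> * Qint L T (\<lambda>x t. C n x * (w n * profile_deriv T (m n) t * dx \<phi> x t)) =
          Qint L T (\<lambda>x t. \<nu> * (S n x * (w n * (w n * profile_deriv T (m n) t) * \<phi> x t)))"
        unfolding parts_C[OF \<phi> continuous_on_mult_left[OF pc(2)] bd] Qint_cmult ..
      also have "\<dots> = Qint L T (\<lambda>x t. m n * (S n x * (profile_deriv T (m n) t * \<phi> x t)))"
        by (simp add: m_def power2_eq_square ac_simps)
      finally show ?thesis using 1 unfolding Qint_cmult by simp
    qed
    have "(\<lambda>n. a n * integral {0..L} (\<lambda>x. S n x * \<phi> x 0)) sums integral {0..L} (\<lambda>x. u x * \<phi> x 0)"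
      using ser(2)[OF continuous_section(2)[OF c(1)], of 0] by (simp add: S_def a_def w_def)
    moreover have "(\<lambda>n. a n * integral {0..L} (\<lambda>x. S n x * \<phi> x 0)) sums
       (- Qint L T (\<lambda>x t. v x t * dt \<phi> x t) + \<nu> * Qint L T (\<lambda>x t. vx x t * dx \<phi> x t) - Qint L T (\<lambda>x t. f x t * \<phi> x t))"
      using sums_diff[OF sums_add[OF sums_minus[OF v(2)[OF c(3)]] sums_mult[OF vx(2)[OF c(2)], of \<nu>]] f(2)[OF c(1)]]
      unfolding mode by (simp add: algebra_simps)
    ultimately have "integral {0..L} (\<lambda>x. u x * \<phi> x 0) =
       - Qint L T (\<lambda>x t. v x t * dt \<phi> x t) + \<nu> * Qint L T (\<lambda>x t. vx x t * dx \<phi> x t) - Qint L T (\<lambda>x t. f x t * \<phi> x t)"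
      by (rule sums_unique2)
    then show "- integral {0..L} (\<lambda>x. u x * \<phi> x 0) - Qint L T (\<lambda>x t. v x t * dt \<phi> x t)
      + \<nu> * Qint L T (\<lambda>x t. vx x t * dx \<phi> x t) = Qint L T (\<lambda>x t. f x t * \<phi> x t)"
      by simp
  qed
qed

section \<open>Weak derivatives\<close>

text \<open>A Lebesgue measurable function agrees with a Borel one off a negligible set, so
  integrals against any \<open>h\<close> whatever coincide. The data are replaced in this way
  because the Fubini lemmas ask for Borel factors.\<close>

lemma L2_on_borel_representative:
  assumes f: "L2_on {a..b::real} f"
  obtains f' where "f' \<in> borel_measurable borel" "L2_on {a..b} f'"
    "\<And>h. integral {a..b} (\<lambda>x. f' x * h x) = integral {a..b} (\<lambda>x. f x * h x)"
proof -
  have "f \<in> borel_measurable (lebesgue_on {a..b})"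
    using f by (simp add: L2_on_def measurable_on_iff_borel_measurable)
  then have "(\<lambda>x. indicator {a..b} x *\<^sub>R f x) \<in> borel_measurable lebesgue"
    by (subst (asm) borel_measurable_restrict_space_iff) (auto simp: mult.commute)
  from completion_ex_borel_measurable_real[OF this]
  obtain f' where f': "f' \<in> borel_measurable lborel"
    and ae: "AE x in lborel. indicator {a..b} x *\<^sub>R f x = f' x" by auto
  from AE_completion[OF ae] obtain N where N: "N \<in> null_sets lebesgue"
    "{x. \<not> indicator {a..b} x *\<^sub>R f x = f' x} \<subseteq> N"
    by (auto simp: eventually_ae_filter)
  have neg: "negligible N" using N(1) by (simp add: negligible_iff_null_sets)
  have eq: "f' x = f x" if "x \<in> {a..b} - N" for x
  proof -
    have "indicator {a..b} x *\<^sub>R f x = f' x" using N(2) that by blast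
    then show ?thesis using that by simp
  qed
  have b: "f' \<in> borel_measurable borel" using f' by simp
  show thesis
  proof (rule that[OF b])
    have "(\<lambda>x. (f' x)\<^sup>2) integrable_on {a..b}"
      by (rule integrable_spike[OF _ neg]) (use f eq in \<open>auto simp: L2_on_def\<close>)
    moreover have "f' \<in> borel_measurable (lebesgue_on {a..b})"
      using b by (intro measurable_restrict_space1 measurable_completion) simp
    ultimately show "L2_on {a..b} f'"
      by (simp add: L2_on_def measurable_on_iff_borel_measurable)
    show "integral {a..b} (\<lambda>x. f' x * h x) = integral {a..b} (\<lambda>x. f x * h x)" for h
      by (rule integral_spike[OF neg]) (simp add: eq)
  qed
qed

text \<open>A continuously differentiable version of \<open>max 0 z\<close>: for
  \<open>z > 0\<close> it equals \<open>z - e + e^2 / (z + e)\<close>, so it stays between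
  \<open>z - e\<close> and \<open>z\<close> and its slope lies in \<open>[0, 1]\<close>. At the kink
  it is flat to first order.\<close>

definition ramp :: "real \<Rightarrow> real \<Rightarrow> real" where
  "ramp e z = (max 0 z)\<^sup>2 / (max 0 z + e)"

definition ramp_deriv :: "real \<Rightarrow> real \<Rightarrow> real" where
  "ramp_deriv e z = 1 - e\<^sup>2 / (max 0 z + e)\<^sup>2"

lemma DERIV_ramp:
  assumes e: "e > 0"
  shows "(ramp e has_real_derivative ramp_deriv e z) (at z)"
proof -
  consider "z < 0" | "z > 0" | "z = 0" by linarith
  then show ?thesis
  proof cases
    case 1
    have "((\<lambda>z. 0) has_real_derivative 0) (at z)" by simp
    then have "(ramp e has_real_derivative 0) (at z)"
      by (rule has_field_derivative_transform_within_open[of _ _ _ "{..<0}"]) (use 1 in \<open>auto simp: ramp_def\<close>)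
    then show ?thesis using 1 e by (simp add: ramp_deriv_def)
  next
    case 2
    have "(2 * z * (z + e) - z\<^sup>2) / ((z + e) * (z + e)) = ((z + e)\<^sup>2 - e\<^sup>2) / (z + e)\<^sup>2"
      by (simp add: power2_eq_square algebra_simps)
    also have "\<dots> = ramp_deriv e z" using 2 e by (simp add: ramp_deriv_def diff_divide_distrib)
    finally have "((\<lambda>z. z\<^sup>2 / (z + e)) has_real_derivative ramp_deriv e z) (at z)"
      using 2 e by (auto intro!: derivative_eq_intros)
    then show ?thesis
      by (rule has_field_derivative_transform_within_open[of _ _ _ "{0<..}"]) (use 2 in \<open>auto simp: ramp_def\<close>)
  next
    case 3
    have "((\<lambda>h. ramp e h / h) \<longlongrightarrow> 0) (at 0)"
    proof (rule Lim_null_comparison)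
      show "((\<lambda>h. \<bar>h\<bar> / e) \<longlongrightarrow> 0) (at 0)"
        using e by (auto intro!: tendsto_eq_intros)
      have "norm (ramp e h / h) \<le> \<bar>h\<bar> / e" for h
      proof (cases "h > 0")
        case True
        then have "norm (ramp e h / h) = h / (h + e)" using e by (simp add: ramp_def power2_eq_square)
        also have "\<dots> \<le> h / e" using True e by (intro divide_left_mono) auto
        finally show ?thesis using True by simp
      qed (use e in \<open>auto simp: ramp_def divide_nonpos_pos\<close>)
      then show "\<forall>\<^sub>F h in at 0. norm (ramp e h / h) \<le> \<bar>h\<bar> / e" by simp
    qed
    then show ?thesis using 3 e by (simp add: has_field_derivative_iff ramp_def ramp_deriv_def)
  qed
qed

lemma ramp_facts:
  assumes e: "e > 0"
  shows "0 \<le> ramp e z" "z - e \<le> ramp e z" "z \<le> 0 \<Longrightarrow> ramp e z = 0"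
    "0 \<le> ramp_deriv e z" "ramp_deriv e z \<le> 1" "continuous_on A (ramp_deriv e)"
proof -
  have p: "max 0 z + e > 0" for z using e by linarith
  show "0 \<le> ramp e z" unfolding ramp_def using p[of z] by simp
  show "z \<le> 0 \<Longrightarrow> ramp e z = 0" by (simp add: ramp_def)
  show "z - e \<le> ramp e z"
  proof (cases "z > 0")
    case True
    have "(z - e) * (z + e) \<le> z\<^sup>2" by (simp add: algebra_simps power2_eq_square)
    then show ?thesis using True e by (simp add: ramp_def pos_le_divide_eq)
  next
    case False
    then show ?thesis using \<open>0 \<le> ramp e z\<close> e by linarith
  qed
  have "e\<^sup>2 \<le> (max 0 z + e)\<^sup>2" using e by (intro power_mono) auto
  then show "0 \<le> ramp_deriv e z" unfolding ramp_deriv_def using p[of z] by simp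
  show "ramp_deriv e z \<le> 1" unfolding ramp_deriv_def by simp
  show "continuous_on A (ramp_deriv e)"
    unfolding ramp_deriv_def[abs_def] by (intro continuous_intros ballI power_not_zero less_imp_neq[OF p, symmetric])
qed

lemma ramp_tendsto:
  assumes e: "e \<longlonglongrightarrow> 0" "\<And>n. e n > 0" and x: "x > 0"
  shows "(\<lambda>n. ramp (e n) (x - e n)) \<longlonglongrightarrow> x" "(\<lambda>n. ramp_deriv (e n) (x - e n)) \<longlonglongrightarrow> 1"
proof -
  have "(\<lambda>n. max 0 (x - e n)) \<longlonglongrightarrow> max 0 (x - 0)" by (intro tendsto_intros e)
  then have m: "(\<lambda>n. max 0 (x - e n)) \<longlonglongrightarrow> x" using x by simp
  have "(\<lambda>n. ramp (e n) (x - e n)) \<longlonglongrightarrow> x\<^sup>2 / (x + 0)"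
    unfolding ramp_def using x by (intro tendsto_intros m e) auto
  then show "(\<lambda>n. ramp (e n) (x - e n)) \<longlonglongrightarrow> x" using x by (simp add: power2_eq_square)
  have "(\<lambda>n. ramp_deriv (e n) (x - e n)) \<longlonglongrightarrow> 1 - 0\<^sup>2 / (x + 0)\<^sup>2"
    unfolding ramp_deriv_def using x by (intro tendsto_intros m e) auto
  then show "(\<lambda>n. ramp_deriv (e n) (x - e n)) \<longlonglongrightarrow> 1" by simp
qed

text \<open>The reparametrisation \<open>\<sigma>\<close> is constant near both endpoints, so \<open>\<phi> \<circ> \<sigma>\<close> has compact support
  as soon as \<open>\<phi>\<close> vanishes at the endpoints; letting \<open>\<sigma>\<close> tend to the identity removes the support condition.\<close>

lemma has_weak_deriv_boundary_zero:
  assumes L: "L > 0" and wd: "has_weak_deriv L f g" and f: "L2_on {0..L} f" and g: "L2_on {0..L} g"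
    and \<phi>: "\<And>x. (\<phi> has_real_derivative \<phi>' x) (at x)" and \<phi>': "continuous_on UNIV \<phi>'"
    and bd: "\<phi> 0 = 0" "\<phi> L = 0"
  shows "integral {0..L} (\<lambda>x. f x * \<phi>' x) = - integral {0..L} (\<lambda>x. g x * \<phi> x)"
proof -
  \<comment> \<open>With \<open>e n\<close> at most \<open>L / 8\<close>, the two ramps below add up
    to at least \<open>L - 4 * e n\<close>, hence to at least \<open>L / 2\<close>, and dividing by
    their sum is safe.\<close>
  define e where "e n = L / 8 / real (Suc n)" for n
  have e: "e n > 0" "e n \<le> L / 8" for n
    using L by (auto simp: e_def field_simps)
  have elim: "e \<longlonglongrightarrow> 0"
    using tendsto_mult_right_zero[OF LIMSEQ_inverse_real_of_nat, of "L / 8"]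
    by (simp only: e_def[abs_def] divide_inverse)
  define a where "a n x = ramp (e n) (x - e n)" for n x
  define b where "b n x = ramp (e n) (L - x - e n)" for n x
  define a' where "a' n x = ramp_deriv (e n) (x - e n)" for n x
  define b' where "b' n x = - ramp_deriv (e n) (L - x - e n)" for n x
  \<comment> \<open>\<open>a n\<close> vanishes up to \<open>e n\<close> and \<open>b n\<close> from
    \<open>L - e n\<close> on, so this quotient is 0 near the left endpoint and \<open>L\<close>
    near the right one. Both ramps tend to the distances from the endpoints, whose sum is
    \<open>L\<close>, which gives the identity in the limit.\<close>
  define \<sigma> where "\<sigma> n x = L * (a n x / (a n x + b n x))" for n x
  define \<sigma>' where "\<sigma>' n x = L * ((a' n x * b n x - a n x * b' n x) / (a n x + b n x)\<^sup>2)" for n x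
  have a0: "0 \<le> a n x" "0 \<le> b n x" for n x
    using ramp_facts(1)[OF e(1)] by (auto simp: a_def b_def)
  have ab: "a n x + b n x \<ge> L / 2" for n x
    using ramp_facts(2)[OF e(1)[of n], of "x - e n"] ramp_facts(2)[OF e(1)[of n], of "L - x - e n"] e(2)[of n]
    by (simp add: a_def b_def)
  have ab0: "a n x + b n x > 0" for n x using ab[of n x] L by linarith
  have da: "(a n has_real_derivative a' n x) (at x)" for n x
  proof -
    have "((\<lambda>x. x - e n) has_real_derivative 1) (at x)" by (auto intro!: derivative_eq_intros)
    from DERIV_chain'[OF this DERIV_ramp[OF e(1)]] show ?thesis
      unfolding a_def[abs_def] a'_def by simp
  qed
  have db: "(b n has_real_derivative b' n x) (at x)" for n x
  proof -
    have "((\<lambda>x. L - x - e n) has_real_derivative - 1) (at x)" by (auto intro!: derivative_eq_intros)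
    from DERIV_chain'[OF this DERIV_ramp[OF e(1)]] show ?thesis
      unfolding b_def[abs_def] b'_def by simp
  qed
  have d\<sigma>: "(\<sigma> n has_real_derivative \<sigma>' n x) (at x)" for n x
  proof -
    have "((\<lambda>x. a n x / (a n x + b n x)) has_real_derivative
        (a' n x * (a n x + b n x) - a n x * (a' n x + b' n x)) / ((a n x + b n x) * (a n x + b n x))) (at x)"
      using ab0[of n x] by (intro DERIV_divide DERIV_add da db) auto
    from DERIV_cmult[OF this, of L] show ?thesis
      unfolding \<sigma>_def[abs_def] \<sigma>'_def by (simp add: power2_eq_square algebra_simps)
  qed
  have ca: "continuous_on UNIV (a n)" "continuous_on UNIV (b n)" for n
    using da db by (meson DERIV_continuous_on has_field_derivative_at_within)+
  have ca': "continuous_on UNIV (a' n)" "continuous_on UNIV (b' n)" for n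
    unfolding a'_def[abs_def] b'_def[abs_def]
    by (intro continuous_intros continuous_on_compose2[OF ramp_facts(6)[where A = UNIV, OF e(1)]] subset_UNIV)+
  have c\<sigma>': "continuous_on UNIV (\<sigma>' n)" for n
    unfolding \<sigma>'_def[abs_def] 
    by (intro continuous_intros ca ca' ballI power_not_zero less_imp_neq[OF ab0, symmetric])
  have c\<sigma>: "continuous_on UNIV (\<sigma> n)" for n
    using d\<sigma> by (meson DERIV_continuous_on has_field_derivative_at_within)
  have c\<phi>: "continuous_on UNIV \<phi>"
    using \<phi> by (meson DERIV_continuous_on has_field_derivative_at_within)
  have \<sigma>b: "\<sigma> n x \<in> {0..L}" for n x
  proof -
    have q1: "a n x / (a n x + b n x) \<le> 1" using a0 ab0[of n x] by (simp add: divide_le_eq)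
    have q2: "0 \<le> a n x / (a n x + b n x)" using a0[of n x] by simp
    show ?thesis
      using mult_left_le[OF q1 less_imp_le[OF L]] mult_nonneg_nonneg[OF less_imp_le[OF L] q2]
      unfolding \<sigma>_def atLeastAtMost_iff by blast
  qed
  \<comment> \<open>Slopes in \<open>[0, 1]\<close> bound the numerator by
    \<open>a n x + b n x\<close>; what remains is \<open>L\<close> over a sum that is at least
    \<open>L / 2\<close>.\<close>
  have \<sigma>'b: "\<bar>\<sigma>' n x\<bar> \<le> 2" for n x
  proof -
    let ?A = "a n x" and ?B = "b n x"
    have a1: "0 \<le> a' n x" "a' n x \<le> 1" and b1: "0 \<le> - b' n x" "- b' n x \<le> 1"
      using ramp_facts(4,5)[OF e(1)] by (auto simp: a'_def b'_def)
    have "0 \<le> a' n x * ?B" "a' n x * ?B \<le> 1 * ?B" "0 \<le> ?A * - b' n x" "?A * - b' n x \<le> ?A * 1"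
      using mult_nonneg_nonneg[OF a1(1) a0(2)] mult_right_mono[OF a1(2) a0(2)]
        mult_nonneg_nonneg[OF a0(1) b1(1)] mult_left_mono[OF b1(2) a0(1)] by blast+
    then have "0 \<le> a' n x * ?B - ?A * b' n x" "a' n x * ?B - ?A * b' n x \<le> ?A + ?B" by simp_all
    then have "\<bar>\<sigma>' n x\<bar> \<le> L * ((?A + ?B) / (?A + ?B)\<^sup>2)"
      unfolding \<sigma>'_def using L by (simp add: abs_mult divide_right_mono)
    also have "\<dots> = L / (?A + ?B)" using ab0[of n x] by (simp add: power2_eq_square)
    also have "\<dots> \<le> 2" using ab[of n x] ab0[of n x] L by (simp add: divide_le_eq)
    finally show ?thesis .
  qed
  have \<sigma>lim: "(\<lambda>n. \<sigma> n x) \<longlonglongrightarrow> x" "(\<lambda>n. \<sigma>' n x) \<longlonglongrightarrow> 1" if x: "x \<in> {0<..<L}" for x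
  proof -
    have A: "(\<lambda>n. a n x) \<longlonglongrightarrow> x" "(\<lambda>n. a' n x) \<longlonglongrightarrow> 1"
      unfolding a_def a'_def using x by (intro ramp_tendsto elim e; simp)+
    have B: "(\<lambda>n. b n x) \<longlonglongrightarrow> L - x" "(\<lambda>n. - b' n x) \<longlonglongrightarrow> 1"
      unfolding b_def b'_def using x ramp_tendsto[OF elim e(1), of "L - x"] by (auto simp: algebra_simps)
    have B': "(\<lambda>n. b' n x) \<longlonglongrightarrow> - 1" using tendsto_minus[OF B(2)] by simp
    have "(\<lambda>n. \<sigma> n x) \<longlonglongrightarrow> L * (x / (x + (L - x)))"
      unfolding \<sigma>_def using L by (intro tendsto_intros A B) auto
    then show "(\<lambda>n. \<sigma> n x) \<longlonglongrightarrow> x" using L by simp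
    have "(\<lambda>n. \<sigma>' n x) \<longlonglongrightarrow> L * ((1 * (L - x) - x * (- 1)) / (x + (L - x))\<^sup>2)"
      unfolding \<sigma>'_def using L by (intro tendsto_intros A B B') auto
    then show "(\<lambda>n. \<sigma>' n x) \<longlonglongrightarrow> 1" using L by (simp add: power2_eq_square)
  qed
  have d\<psi>: "((\<lambda>x. \<phi> (\<sigma> n x)) has_real_derivative \<phi>' (\<sigma> n x) * \<sigma>' n x) (at x)" for n x
    by (rule DERIV_chain'[OF d\<sigma> \<phi>])
  have c1: "continuous_on UNIV (\<lambda>x. \<phi>' (\<sigma> n x) * \<sigma>' n x)" for n
    by (intro continuous_intros c\<sigma>' continuous_on_compose2[OF \<phi>' c\<sigma>]) auto
  have c2: "continuous_on UNIV (\<lambda>x. \<phi> (\<sigma> n x))" for n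
    by (intro continuous_on_compose2[OF c\<phi> c\<sigma>]) auto
  have supp: "\<phi> (\<sigma> n x) = 0" if x: "x \<notin> {e n..L - e n}" for n x
  proof -
    consider "x \<le> e n" | "L - x \<le> e n" using x by fastforce
    then show ?thesis
    proof cases
      case 1
      then have "a n x = 0" unfolding a_def using ramp_facts(3)[OF e(1)] by simp
      then show ?thesis using bd by (simp add: \<sigma>_def)
    next
      case 2
      then have "b n x = 0" unfolding b_def using ramp_facts(3)[OF e(1)] by simp
      then have "\<sigma> n x = L" using ab0[of n x] by (simp add: \<sigma>_def)
      then show ?thesis using bd by simp
    qed
  qed
  have test: "test_fun L (\<lambda>x. \<phi> (\<sigma> n x))" for n
    unfolding test_fun_def
  proof (intro conjI allI)
    show "(\<lambda>x. \<phi> (\<sigma> n x)) differentiable at x" for x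
      using d\<psi> real_differentiable_def by blast
    show "continuous_on UNIV (deriv (\<lambda>x. \<phi> (\<sigma> n x)))"
      using c1[of n] DERIV_imp_deriv[OF d\<psi>] by (simp add: ext)
    have "0 < e n \<and> e n \<le> L - e n \<and> L - e n < L" using e[of n] L by auto
    then show "\<exists>a b. 0 < a \<and> a \<le> b \<and> b < L \<and> (\<forall>x. x \<notin> {a..b} \<longrightarrow> \<phi> (\<sigma> n x) = 0)"
      using supp[of _ n] by blast
  qed
  have eqn: "integral {0..L} (\<lambda>x. f x * (\<phi>' (\<sigma> n x) * \<sigma>' n x)) = - integral {0..L} (\<lambda>x. g x * \<phi> (\<sigma> n x))" for n
    using wd[unfolded has_weak_deriv_def, rule_format, OF test[of n]]
    unfolding DERIV_imp_deriv[OF d\<psi>] .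
  \<comment> \<open>At the endpoints the slope of the reparametrisation is 0 for every
    \<open>n\<close>, so its convergence to 1 holds only inside.\<close>
  define S where "S = {0<..<L}"
  have S: "integral S h = integral {0..L} h" "h integrable_on S \<longleftrightarrow> h integrable_on {0..L}" for h :: "real \<Rightarrow> real"
    unfolding S_def using integral_open_interval_real[of 0 L h] integrable_on_open_interval_real[of h 0 L] by auto
  have bnd: "\<exists>C. \<forall>x\<in>{0..L}. \<bar>h x\<bar> \<le> C" if "continuous_on UNIV h" for h :: "real \<Rightarrow> real"
  proof -
    have "compact (h ` {0..L})" by (intro compact_continuous_image continuous_on_subset[OF that]) auto
    from compact_imp_bounded[OF this] show ?thesis unfolding bounded_iff by simp
  qed
  obtain C0 where C0: "\<And>x. x \<in> {0..L} \<Longrightarrow> \<bar>\<phi> x\<bar> \<le> C0" using bnd[OF c\<phi>] by blast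
  obtain C1 where C1: "\<And>x. x \<in> {0..L} \<Longrightarrow> \<bar>\<phi>' x\<bar> \<le> C1" using bnd[OF \<phi>'] by blast
  have int: "(\<lambda>x. h x * c x) integrable_on S" if "L2_on {0..L} h" "continuous_on UNIV c" for h c
    unfolding S by (intro L2_on_integrable that sets_lebesgue_box L2_on_continuous continuous_on_subset[OF that(2)]) auto
  have absint: "(\<lambda>x. \<bar>h x\<bar> * c) integrable_on S" if "L2_on {0..L} h" for h and c :: real
    unfolding S using L2_on_absolutely_integrable[OF that]
    by (intro integrable_on_mult_left) (simp add: absolutely_integrable_on_def)
  have lim1: "(\<lambda>n. integral S (\<lambda>x. f x * (\<phi>' (\<sigma> n x) * \<sigma>' n x))) \<longlonglongrightarrow> integral S (\<lambda>x. f x * \<phi>' x)"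
  proof (rule dominated_convergence(2))
    show "(\<lambda>x. f x * (\<phi>' (\<sigma> n x) * \<sigma>' n x)) integrable_on S" for n by (intro int f c1)
    show "(\<lambda>x. \<bar>f x\<bar> * (C1 * 2)) integrable_on S" by (rule absint[OF f])
    fix n x assume "x \<in> S"
    show "norm (f x * (\<phi>' (\<sigma> n x) * \<sigma>' n x)) \<le> \<bar>f x\<bar> * (C1 * 2)"
      unfolding real_norm_def abs_mult
      using C1[OF \<sigma>b[of n x]] by (intro mult_left_mono mult_mono \<sigma>'b) auto
  next
    fix x assume x: "x \<in> S"
    have "isCont \<phi>' x" using \<phi>' by (simp add: continuous_on_eq_continuous_at)
    from isCont_tendsto_compose[OF this \<sigma>lim(1)]
    have "(\<lambda>n. f x * (\<phi>' (\<sigma> n x) * \<sigma>' n x)) \<longlonglongrightarrow> f x * (\<phi>' x * 1)"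
      using x by (intro tendsto_intros \<sigma>lim) (auto simp: S_def)
    then show "(\<lambda>n. f x * (\<phi>' (\<sigma> n x) * \<sigma>' n x)) \<longlonglongrightarrow> f x * \<phi>' x" by simp
  qed
  have lim2: "(\<lambda>n. integral S (\<lambda>x. g x * \<phi> (\<sigma> n x))) \<longlonglongrightarrow> integral S (\<lambda>x. g x * \<phi> x)"
  proof (rule dominated_convergence(2))
    show "(\<lambda>x. g x * \<phi> (\<sigma> n x)) integrable_on S" for n by (intro int g c2)
    show "(\<lambda>x. \<bar>g x\<bar> * C0) integrable_on S" by (rule absint[OF g])
    fix n x assume "x \<in> S"
    show "norm (g x * \<phi> (\<sigma> n x)) \<le> \<bar>g x\<bar> * C0"
      unfolding real_norm_def abs_mult using C0[OF \<sigma>b[of n x]] by (intro mult_left_mono) auto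
  next
    fix x assume x: "x \<in> S"
    have "isCont \<phi> x" using \<phi> DERIV_isCont by blast
    from isCont_tendsto_compose[OF this \<sigma>lim(1)]
    show "(\<lambda>n. g x * \<phi> (\<sigma> n x)) \<longlonglongrightarrow> g x * \<phi> x"
      using x by (intro tendsto_intros) (auto simp: S_def)
  qed
  show ?thesis
    using LIMSEQ_unique[OF lim1] tendsto_minus[OF lim2] unfolding S eqn by blast
qed

section \<open>Steering the density\<close>

text \<open>Fubini on the triangle \<open>y \<le> x\<close> replaces differentiating the primitive,
  which is only absolutely continuous. The inner integral is \<open>\<psi> L - \<psi> y\<close>, and
  the mean zero condition kills the term with \<open>\<psi> L\<close>; this is how the primitive
  comes to have zero trace against arbitrary test functions.\<close>

lemma primitive_parts:
  fixes f \<psi> \<psi>' :: "real \<Rightarrow> real"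
  assumes L: "L > 0" and f: "f \<in> borel_measurable borel" "f absolutely_integrable_on {0..L}"
    and mean: "integral {0..L} f = 0"
    and \<psi>: "\<And>x. (\<psi> has_real_derivative \<psi>' x) (at x)" and \<psi>': "continuous_on UNIV \<psi>'"
  shows "integral {0..L} (\<lambda>x. integral {0..x} f * \<psi>' x) = - integral {0..L} (\<lambda>y. f y * \<psi> y)"
proof -
  define H where "H y x = (if y \<le> x then \<psi>' x else 0)" for y x
  have [measurable]: "\<psi>' \<in> borel_measurable borel" by (rule borel_measurable_continuous_onI[OF \<psi>'])
  have Hm: "(\<lambda>(y,x). H y x) \<in> borel_measurable (borel \<Otimes>\<^sub>M borel)" unfolding H_def by measurable
  have "compact (\<psi>' ` {0..L})" by (intro compact_continuous_image continuous_on_subset[OF \<psi>']) auto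
  from compact_imp_bounded[OF this] obtain C where C: "\<forall>x\<in>{0..L}. \<bar>\<psi>' x\<bar> \<le> C"
    unfolding bounded_iff by auto
  have Hb: "\<bar>H y x\<bar> \<le> C" if "y \<in> {0..L}" "x \<in> {0..L}" for y x
    using bspec[OF C that(2)] by (auto simp: H_def)
  have fi: "f integrable_on {0..L}" using f by (simp add: absolutely_integrable_on_def)
  have c\<psi>: "continuous_on UNIV \<psi>"
    using \<psi> by (meson DERIV_continuous_on has_field_derivative_at_within)
  have inner_x: "integral {0..L} (\<lambda>x. H y x) = \<psi> L - \<psi> y" if y: "y \<in> {0..L}" for y
  proof -
    have "integral {0..L} (\<lambda>x. H y x) = integral {0..L} (\<lambda>x. if x \<in> {y..L} then \<psi>' x else 0)"
      by (intro integral_cong) (auto simp: H_def)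
    also have "\<dots> = integral {y..L} \<psi>'" 
      using y by (simp only: Henstock_Kurzweil_Integration.integral_restrict_Int) (simp add: Int_absorb2)
    also have "\<dots> = \<psi> L - \<psi> y"
      using y by (intro integral_unique fundamental_theorem_of_calculus)
        (auto simp flip: has_real_derivative_iff_has_vector_derivative intro: has_field_derivative_at_within \<psi>)
    finally show ?thesis .
  qed
  have inner_y: "integral {0..L} (\<lambda>y. f y * H y x) = integral {0..x} f * \<psi>' x" if x: "x \<in> {0..L}" for x
  proof -
    have "integral {0..L} (\<lambda>y. f y * H y x) = integral {0..L} (\<lambda>y. (if y \<in> {0..x} then f y else 0) * \<psi>' x)"
      by (intro integral_cong) (auto simp: H_def)
    also have "\<dots> = integral {0..L} (\<lambda>y. if y \<in> {0..x} then f y else 0) * \<psi>' x" by simp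
    also have "integral {0..L} (\<lambda>y. if y \<in> {0..x} then f y else 0) = integral {0..x} f"
      using x by (simp only: Henstock_Kurzweil_Integration.integral_restrict_Int) (simp add: Int_absorb2)
    finally show ?thesis .
  qed
  have fi2: "(\<lambda>y. f y * \<psi> y) integrable_on {0..L}"
    by (intro integrable_mult_continuous f continuous_on_subset[OF c\<psi>]) simp
  have "integral {0..L} (\<lambda>x. integral {0..x} f * \<psi>' x) = integral {0..L} (\<lambda>x. integral {0..L} (\<lambda>y. f y * H y x))"
    by (intro integral_cong) (simp add: inner_y)
  also have "\<dots> = integral {0..L} (\<lambda>y. f y * integral {0..L} (H y))"
    using Qint_Fubini_bounded(1,2)[OF f Hm Hb] by simp
  also have "\<dots> = integral {0..L} (\<lambda>y. f y * \<psi> L - f y * \<psi> y)"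
    by (intro integral_cong) (simp add: inner_x right_diff_distrib)
  also have "\<dots> = integral {0..L} (\<lambda>y. f y * \<psi> L) - integral {0..L} (\<lambda>y. f y * \<psi> y)"
    by (intro integral_diff fi2 integrable_on_mult_left fi)
  finally show ?thesis using mean by simp
qed

lemma L2Q_add: "L2Q L T f \<Longrightarrow> L2Q L T g \<Longrightarrow> L2Q L T (\<lambda>x t. f x t + g x t)"
  using L2_on_add[OF sets_lebesgue_box(2)] by (fastforce simp: L2Q_def case_prod_unfold)

lemma L2Q_cmult: "L2Q L T f \<Longrightarrow> L2Q L T (\<lambda>x t. c * f x t)"
  using L2_on_cmult[OF sets_lebesgue_box(2)] by (fastforce simp: L2Q_def case_prod_unfold)

lemma Qint_mult_add:
  assumes "L2Q L T f" "L2Q L T g" "continuous_on UNIV (\<lambda>(x,t). H x t)"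
  shows "Qint L T (\<lambda>x t. (f x t + g x t) * H x t) =
    Qint L T (\<lambda>x t. f x t * H x t) + Qint L T (\<lambda>x t. g x t * H x t)"
  unfolding distrib_right
  by (intro Qint_add Qint_L2_continuous_integrable assms)

lemma Qint_mult_cmult:
  "Qint L T (\<lambda>x t. (c * f x t) * H x t) = c * Qint L T (\<lambda>x t. f x t * H x t)"
  by (simp add: mult.assoc Qint_cmult)

text \<open>A velocity \<open>z = b(t) \<integral>\<^sub>0\<^sup>x \<rho>\<close> with \<open>\<integral> b = 1\<close> transports exactly the initial density out by time \<open>T\<close>;
  it vanishes at both endpoints because \<open>\<rho>\<close> has mean zero.\<close>

theorem density_steering:
  assumes L: "L > 0" and T: "T > 0" and \<rho>0: "H1m L \<rho>0"
  obtains z zx f r s where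
    "L2Q L T z" "L2Q L T zx" "L2Q L T f" "L2Q L T r" "L2Q L T s"
    "\<And>\<phi>. C1_2 \<phi> \<Longrightarrow> Qint L T (\<lambda>x t. z x t * dx \<phi> x t) = - Qint L T (\<lambda>x t. zx x t * \<phi> x t)"
    "\<And>\<phi>. C1_2 \<phi> \<Longrightarrow> (\<forall>t. \<phi> 0 t = 0 \<and> \<phi> L t = 0) \<Longrightarrow>
      - Qint L T (\<lambda>x t. z x t * dt \<phi> x t)
      + \<nu> * Qint L T (\<lambda>x t. zx x t * dx \<phi> x t) = Qint L T (\<lambda>x t. f x t * \<phi> x t)"
    "\<And>\<phi>. C1_2 \<phi> \<Longrightarrow> - integral {0..L} (\<lambda>x. \<rho>0 x * \<phi> x 0) - Qint L T (\<lambda>x t. r x t * dt \<phi> x t)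
      + Qint L T (\<lambda>x t. zx x t * \<phi> x t) = 0"
    "\<And>\<phi>. C1_2 \<phi> \<Longrightarrow> (\<forall>t. \<phi> 0 t = 0 \<and> \<phi> L t = 0) \<Longrightarrow>
      Qint L T (\<lambda>x t. r x t * dx \<phi> x t) = - Qint L T (\<lambda>x t. s x t * \<phi> x t)"
proof -
  obtain \<rho>1 where \<rho>0L: "L2_on {0..L} \<rho>0" and \<rho>1L: "L2_on {0..L} \<rho>1" and wd0: "has_weak_deriv L \<rho>0 \<rho>1"
    and mean0: "integral {0..L} \<rho>0 = 0"
    using \<rho>0 by (auto simp: H1m_def H1_def)
  obtain p where p: "p \<in> borel_measurable borel" and pL: "L2_on {0..L} p"
    and p0: "\<And>h. integral {0..L} (\<lambda>x. p x * h x) = integral {0..L} (\<lambda>x. \<rho>0 x * h x)"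
    using L2_on_borel_representative[OF \<rho>0L] by blast
  obtain q where q: "q \<in> borel_measurable borel" and qL: "L2_on {0..L} q"
    and q0: "\<And>h. integral {0..L} (\<lambda>x. q x * h x) = integral {0..L} (\<lambda>x. \<rho>1 x * h x)"
    using L2_on_borel_representative[OF \<rho>1L] by blast
  have wd: "has_weak_deriv L p q" using wd0 unfolding has_weak_deriv_def p0 q0 .
  have mean: "integral {0..L} p = 0" using p0[of "\<lambda>_. 1"] mean0 by simp
  have pi: "p absolutely_integrable_on {0..L}" and qi: "q absolutely_integrable_on {0..L}"
    using L2_on_absolutely_integrable pL qL by auto
  \<comment> \<open>Clamping the upper limit to the interval makes the primitive continuous on the
    whole line without changing it on \<open>{0..L}\<close>.\<close>
  define P where "P x = integral {0..max 0 (min L x)} p" for x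
  have Pc: "continuous_on UNIV P"
  proof -
    have "continuous_on {0..L} (\<lambda>x. integral {0..x} p)"
      using pi by (intro indefinite_integral_continuous_1) (simp add: absolutely_integrable_on_def)
    then show ?thesis unfolding P_def[abs_def]
      by (rule continuous_on_compose2[where t = "{0..L}"]) (use L in \<open>auto intro!: continuous_intros\<close>)
  qed
  have Pb: "P \<in> borel_measurable borel" "P absolutely_integrable_on {0..L}" "L2_on {0..L} P"
    using Pc by (auto intro!: borel_measurable_continuous_onI absolutely_integrable_continuous_real L2_on_continuous
        intro: continuous_on_subset)
  \<comment> \<open>The integral of \<open>6 * t * (T - t)\<close> over \<open>{0..T}\<close> is
    \<open>T ^ 3\<close>, so \<open>b\<close> has integral 1. It vanishes at both ends, so this
    velocity starts and ends at rest, and \<open>B\<close>, which is 1 minus the running integral of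
    \<open>b\<close>, falls from 1 to 0.\<close>
  define c where "c = 1 / T ^ 3"
  define b where "b t = c * (6 * t * (T - t))" for t
  define b' where "b' t = c * (6 * (T - 2 * t))" for t
  define B where "B t = 1 - c * (t\<^sup>2 * (3 * T - 2 * t))" for t
  have db: "(b has_real_derivative b' t) (at t)" for t
    unfolding b_def[abs_def] b'_def using T by (auto intro!: derivative_eq_intros simp: algebra_simps)
  have dB: "(B has_real_derivative - b t) (at t)" for t
    unfolding B_def[abs_def] b_def using T
    by (auto intro!: derivative_eq_intros simp: algebra_simps power2_eq_square)
  have cb: "continuous_on UNIV b" "continuous_on UNIV b'" "continuous_on UNIV B" "continuous_on UNIV (\<lambda>t. - b t)"
    unfolding b_def[abs_def] b'_def[abs_def] B_def[abs_def] using T by (auto intro!: continuous_intros)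
  have b0: "b 0 = 0" "b T = 0" "B 0 = 1" "B T = 0"
    using T by (auto simp: b_def B_def c_def power2_eq_square power3_eq_cube)
  have one: "continuous_on UNIV (\<lambda>(x::real,t::real). 1::real)" by (simp add: case_prod_unfold)
  have ck: "continuous_on UNIV (\<lambda>(x::real,t). k t)" if "continuous_on UNIV k" for k :: "real \<Rightarrow> real"
    using continuous_mult_snd[OF one that] by simp
  have f1: "L2Q L T (\<lambda>x t. P x * b' t)" and f2: "L2Q L T (\<lambda>x t. (- \<nu>) * (q x * b t))"
    by (intro L2Q_cmult L2Q_mult_continuous Pb p pL q qL ck cb)+
  show thesis
  \<comment> \<open>The density is \<open>p * B\<close>, and \<open>B' = - b\<close> balances the
    velocity gradient \<open>p * b\<close>. As \<open>q\<close> is the weak derivative of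
    \<open>p\<close>, the heat residual of \<open>P * b\<close> is
    \<open>P * b' - \<nu> * q * b\<close> and the density gradient is \<open>q * B\<close>.\<close>
  proof (rule that[of "\<lambda>x t. P x * b t" "\<lambda>x t. p x * b t" "\<lambda>x t. P x * b' t + (- \<nu>) * (q x * b t)"
        "\<lambda>x t. p x * B t" "\<lambda>x t. q x * B t"])
    show "L2Q L T (\<lambda>x t. P x * b t)" "L2Q L T (\<lambda>x t. p x * b t)" "L2Q L T (\<lambda>x t. p x * B t)" "L2Q L T (\<lambda>x t. q x * B t)"
      by (intro L2Q_cmult L2Q_mult_continuous Pb p pL q qL ck cb)+
    show "L2Q L T (\<lambda>x t. P x * b' t + (- \<nu>) * (q x * b t))"
      by (intro L2Q_add f1 f2)
  next
    fix \<phi> assume \<phi>: "C1_2 \<phi>"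
    note c = C1_2_continuous[OF \<phi>]
    have "integral {0..L} (\<lambda>x. P x * dx \<phi> x t) = - integral {0..L} (\<lambda>x. p x * \<phi> x t)" for t
    proof -
      have "integral {0..L} (\<lambda>x. P x * dx \<phi> x t) = integral {0..L} (\<lambda>x. integral {0..x} p * dx \<phi> x t)"
        by (intro integral_cong) (auto simp: P_def)
      then show ?thesis
        using primitive_parts[OF L p pi mean C1_2_derivs(1)[OF \<phi>] continuous_section(2)[OF c(2)]] by simp
    qed
    from Qint_parts_weak[OF Pb(1,2) p pi \<phi> cb(1) this]
    show "Qint L T (\<lambda>x t. P x * b t * dx \<phi> x t) = - Qint L T (\<lambda>x t. p x * b t * \<phi> x t)"
      by (simp add: mult.assoc)
    have "Qint L T (\<lambda>x t. p x * (B t * dt \<phi> x t)) =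
       - integral {0..L} (\<lambda>x. p x * \<phi> x 0) - Qint L T (\<lambda>x t. (-1) * (p x * (b t * \<phi> x t)))"
      using Qint_parts_time[OF T p pi \<phi> dB cb(4)] b0 by simp
    then show "- integral {0..L} (\<lambda>x. \<rho>0 x * \<phi> x 0) - Qint L T (\<lambda>x t. p x * B t * dt \<phi> x t)
      + Qint L T (\<lambda>x t. p x * b t * \<phi> x t) = 0"
      unfolding Qint_cmult by (simp add: p0 mult.assoc)
    assume bd: "\<forall>t. \<phi> 0 t = 0 \<and> \<phi> L t = 0"
    \<comment> \<open>The slices of \<open>\<phi>\<close> vanish at the endpoints but need not have
      compact support, hence the extended form of the weak derivative.\<close>
    have w: "integral {0..L} (\<lambda>x. p x * dx \<phi> x t) = - integral {0..L} (\<lambda>x. q x * \<phi> x t)" for t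
      using bd by (intro has_weak_deriv_boundary_zero[OF L wd pL qL C1_2_derivs(1)[OF \<phi>] continuous_section(2)[OF c(2)]]) auto
    note W = Qint_parts_weak[OF p pi q qi \<phi> _ w]
    show "Qint L T (\<lambda>x t. p x * B t * dx \<phi> x t) = - Qint L T (\<lambda>x t. q x * B t * \<phi> x t)"
      using W[OF cb(3)] by (simp add: mult.assoc)
    have "Qint L T (\<lambda>x t. P x * (b t * dt \<phi> x t)) = - Qint L T (\<lambda>x t. P x * (b' t * \<phi> x t))"
      using Qint_parts_time[OF T Pb(1,2) \<phi> db cb(2)] b0 by simp
    then show "- Qint L T (\<lambda>x t. P x * b t * dt \<phi> x t) + \<nu> * Qint L T (\<lambda>x t. p x * b t * dx \<phi> x t) =
        Qint L T (\<lambda>x t. (P x * b' t + (- \<nu>) * (q x * b t)) * \<phi> x t)"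
      unfolding Qint_mult_add[OF f1 f2 c(1)] Qint_mult_cmult
      using W[OF cb(1)] by (simp add: mult.assoc)
  qed
qed

section \<open>Null controllability\<close>

theorem theorem1p2:
  fixes L T rhobar thetabar R cv kappa mu lam :: real
    and rho0 u0 theta0 :: "real \<Rightarrow> real"
  assumes "L > 0" and "rhobar > 0" and "thetabar > 0" and "R > 0" and "cv > 0"
    and "kappa > 0" and "mu > 0" and "lam + mu \<ge> 0"
    and "H1m L rho0" and "L2_on {0..L} u0" and "L2_on {0..L} theta0"
    and "T > 0"
  shows "\<exists>g h. L2Q L T g \<and> L2Q L T h \<and>
           (\<exists>rho u theta. weak_solution L T rhobar thetabar R cv kappa mu lam g h
              rho0 u0 theta0 (\<lambda>x. 0) (\<lambda>x. 0) (\<lambda>x. 0) rho u theta)"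
proof -
  define \<nu> where "\<nu> = (lam + 2 * mu) / rhobar"
  define \<kappa> where "\<kappa> = kappa / (rhobar * cv)"
  define \<alpha> where "\<alpha> = R * thetabar / rhobar"
  define \<beta> where "\<beta> = R * thetabar / cv"
  \<comment> \<open>Positivity comes from \<open>lam + 2 * mu = (lam + mu) + mu\<close>; the sign of
    \<open>lam\<close> alone is free.\<close>
  have \<nu>: "\<nu> > 0" using assms by (simp add: \<nu>_def)
  have \<kappa>: "\<kappa> > 0" using assms by (simp add: \<kappa>_def)
  obtain v vx f1 r1 s1 where
    L1: "L2Q L T v" "L2Q L T vx" "L2Q L T f1" "L2Q L T r1" "L2Q L T s1" and
    v_x: "\<And>\<phi>. C1_2 \<phi> \<Longrightarrow> Qint L T (\<lambda>x t. v x t * dx \<phi> x t) = - Qint L T (\<lambda>x t. vx x t * \<phi> x t)" and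
    v_heat: "\<And>\<phi>. C1_2 \<phi> \<Longrightarrow> (\<forall>t. \<phi> 0 t = 0 \<and> \<phi> L t = 0) \<Longrightarrow>
      - integral {0..L} (\<lambda>x. u0 x * \<phi> x 0) - Qint L T (\<lambda>x t. v x t * dt \<phi> x t)
      + \<nu> * Qint L T (\<lambda>x t. vx x t * dx \<phi> x t) = Qint L T (\<lambda>x t. f1 x t * \<phi> x t)" and
    r1_t: "\<And>\<phi>. C1_2 \<phi> \<Longrightarrow> Qint L T (\<lambda>x t. r1 x t * dt \<phi> x t) = - Qint L T (\<lambda>x t. vx x t * \<phi> x t)" and
    r1_x: "\<And>\<phi>. C1_2 \<phi> \<Longrightarrow> (\<forall>t. \<phi> 0 t = 0 \<and> \<phi> L t = 0) \<Longrightarrow>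
      Qint L T (\<lambda>x t. r1 x t * dx \<phi> x t) = Qint L T (\<lambda>x t. s1 x t * \<phi> x t)"
    by (rule heat_steering[OF assms(1,12) \<nu> assms(10)]) (rule that; assumption)
  obtain th thx f3 where
    L3: "L2Q L T th" "L2Q L T thx" "L2Q L T f3" and
    th_x: "\<And>\<phi>. C1_2 \<phi> \<Longrightarrow> Qint L T (\<lambda>x t. th x t * dx \<phi> x t) = - Qint L T (\<lambda>x t. thx x t * \<phi> x t)" and
    th_heat: "\<And>\<phi>. C1_2 \<phi> \<Longrightarrow> (\<forall>t. \<phi> 0 t = 0 \<and> \<phi> L t = 0) \<Longrightarrow>
      - integral {0..L} (\<lambda>x. theta0 x * \<phi> x 0) - Qint L T (\<lambda>x t. th x t * dt \<phi> x t)
      + \<kappa> * Qint L T (\<lambda>x t. thx x t * dx \<phi> x t) = Qint L T (\<lambda>x t. f3 x t * \<phi> x t)"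
    by (rule heat_steering[OF assms(1,12) \<kappa> assms(11)]) (rule that; assumption)
  obtain z zx f2 r2 s2 where
    L2: "L2Q L T z" "L2Q L T zx" "L2Q L T f2" "L2Q L T r2" "L2Q L T s2" and
    z_x: "\<And>\<phi>. C1_2 \<phi> \<Longrightarrow> Qint L T (\<lambda>x t. z x t * dx \<phi> x t) = - Qint L T (\<lambda>x t. zx x t * \<phi> x t)" and
    z_heat: "\<And>\<phi>. C1_2 \<phi> \<Longrightarrow> (\<forall>t. \<phi> 0 t = 0 \<and> \<phi> L t = 0) \<Longrightarrow>
      - Qint L T (\<lambda>x t. z x t * dt \<phi> x t)
      + \<nu> * Qint L T (\<lambda>x t. zx x t * dx \<phi> x t) = Qint L T (\<lambda>x t. f2 x t * \<phi> x t)" and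
    r2_t: "\<And>\<phi>. C1_2 \<phi> \<Longrightarrow> - integral {0..L} (\<lambda>x. rho0 x * \<phi> x 0) - Qint L T (\<lambda>x t. r2 x t * dt \<phi> x t)
      + Qint L T (\<lambda>x t. zx x t * \<phi> x t) = 0" and
    r2_x: "\<And>\<phi>. C1_2 \<phi> \<Longrightarrow> (\<forall>t. \<phi> 0 t = 0 \<and> \<phi> L t = 0) \<Longrightarrow>
      Qint L T (\<lambda>x t. r2 x t * dx \<phi> x t) = - Qint L T (\<lambda>x t. s2 x t * \<phi> x t)"
    by (rule density_steering[OF assms(1,12,9), where \<nu> = \<nu>]) (rule that; assumption)
  \<comment> \<open>The density steering is normalised to unit coefficient, so its velocity is
    divided by \<open>rhobar\<close>, while the density displaced by \<open>v\<close> is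
    \<open>- rhobar\<close> times its accumulated gradient \<open>r1\<close>.\<close>
  define u where "u x t = v x t + 1 / rhobar * z x t" for x t
  define ux where "ux x t = vx x t + 1 / rhobar * zx x t" for x t
  define rho where "rho x t = (- rhobar) * r1 x t + r2 x t" for x t
  \<comment> \<open>The residual of the velocity equation: heat sources, pressure gradient and
    temperature gradient. Since \<open>s1\<close> is minus the gradient of \<open>r1\<close> and
    \<open>s2\<close> the gradient of \<open>r2\<close>, the gradient of \<open>rho\<close> is
    \<open>rhobar * s1 + s2\<close>.\<close>
  define g where "g x t = f1 x t + (1 / rhobar * f2 x t + (\<alpha> * rhobar * s1 x t + (\<alpha> * s2 x t + R * thx x t)))" for x t
  define h where "h x t = f3 x t + \<beta> * ux x t" for x t
  have LL: "L2Q L T u" "L2Q L T ux" "L2Q L T rho"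
    unfolding u_def ux_def rho_def by (intro L2Q_add L2Q_cmult L1 L2)+
  have Lg: "L2Q L T g" "L2Q L T h"
    unfolding g_def h_def by (intro L2Q_add L2Q_cmult L1 L2 L3 LL)+
  have Qu: "Qint L T (\<lambda>x t. u x t * H x t) = Qint L T (\<lambda>x t. v x t * H x t) + 1 / rhobar * Qint L T (\<lambda>x t. z x t * H x t)"
    and Qux: "Qint L T (\<lambda>x t. ux x t * H x t) = Qint L T (\<lambda>x t. vx x t * H x t) + 1 / rhobar * Qint L T (\<lambda>x t. zx x t * H x t)"
    and Qrho: "Qint L T (\<lambda>x t. rho x t * H x t) = (- rhobar) * Qint L T (\<lambda>x t. r1 x t * H x t) + Qint L T (\<lambda>x t. r2 x t * H x t)"
    and Qg: "Qint L T (\<lambda>x t. g x t * H x t) = Qint L T (\<lambda>x t. f1 x t * H x t) + (1 / rhobar * Qint L T (\<lambda>x t. f2 x t * H x t)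
      + (\<alpha> * rhobar * Qint L T (\<lambda>x t. s1 x t * H x t) + (\<alpha> * Qint L T (\<lambda>x t. s2 x t * H x t) + R * Qint L T (\<lambda>x t. thx x t * H x t))))"
    and Qh: "Qint L T (\<lambda>x t. h x t * H x t) = Qint L T (\<lambda>x t. f3 x t * H x t) + \<beta> * Qint L T (\<lambda>x t. ux x t * H x t)"
    if H: "continuous_on UNIV (\<lambda>(x,t). H x t)" for H
    unfolding u_def ux_def rho_def g_def h_def
    by (simp_all only: Qint_mult_add Qint_mult_cmult L2Q_add L2Q_cmult L1 L2 L3 H)
  have "weak_solution L T rhobar thetabar R cv kappa mu lam g h
      rho0 u0 theta0 (\<lambda>x. 0) (\<lambda>x. 0) (\<lambda>x. 0) rho u th"
    unfolding weak_solution_def L2H10_def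
    unfolding \<nu>_def[symmetric] \<kappa>_def[symmetric] \<alpha>_def[symmetric] \<beta>_def[symmetric]
  proof (rule conjI[OF LL(3)], rule exI[of _ ux], rule exI[of _ thx], intro conjI allI impI LL L3)
    fix \<phi> assume \<phi>: "C1_2 \<phi>"
    note c = C1_2_continuous[OF \<phi>]
    show "Qint L T (\<lambda>x t. u x t * dx \<phi> x t) = - Qint L T (\<lambda>x t. ux x t * \<phi> x t)"
      by (simp add: Qu[OF c(2)] Qux[OF c(1)] v_x[OF \<phi>] z_x[OF \<phi>])
    show "Qint L T (\<lambda>x t. th x t * dx \<phi> x t) = - Qint L T (\<lambda>x t. thx x t * \<phi> x t)"
      by (rule th_x[OF \<phi>])
    show "integral {0..L} (\<lambda>x. 0 * \<phi> x T) - integral {0..L} (\<lambda>x. rho0 x * \<phi> x 0)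
          - Qint L T (\<lambda>x t. rho x t * dt \<phi> x t) + rhobar * Qint L T (\<lambda>x t. ux x t * \<phi> x t) = 0"
      using r2_t[OF \<phi>] assms(2) unfolding Qrho[OF c(3)] Qux[OF c(1)] r1_t[OF \<phi>]
      by (simp add: distrib_left)
    assume bd: "\<forall>t. \<phi> 0 t = 0 \<and> \<phi> L t = 0"
    have "1 / rhobar * (- Qint L T (\<lambda>x t. z x t * dt \<phi> x t) + \<nu> * Qint L T (\<lambda>x t. zx x t * dx \<phi> x t)) =
        1 / rhobar * Qint L T (\<lambda>x t. f2 x t * \<phi> x t)"
      unfolding z_heat[OF \<phi> bd] ..
    then show "integral {0..L} (\<lambda>x. 0 * \<phi> x T) - integral {0..L} (\<lambda>x. u0 x * \<phi> x 0)
          - Qint L T (\<lambda>x t. u x t * dt \<phi> x t) + \<nu> * Qint L T (\<lambda>x t. ux x t * dx \<phi> x t)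
          - \<alpha> * Qint L T (\<lambda>x t. rho x t * dx \<phi> x t) + R * Qint L T (\<lambda>x t. thx x t * \<phi> x t)
          = Qint L T (\<lambda>x t. g x t * \<phi> x t)"
      using v_heat[OF \<phi> bd]
      unfolding Qu[OF c(3)] Qux[OF c(2)] Qrho[OF c(2)] Qg[OF c(1)] r1_x[OF \<phi> bd] r2_x[OF \<phi> bd]
      by (simp add: algebra_simps)
    show "integral {0..L} (\<lambda>x. 0 * \<phi> x T) - integral {0..L} (\<lambda>x. theta0 x * \<phi> x 0)
          - Qint L T (\<lambda>x t. th x t * dt \<phi> x t) + \<kappa> * Qint L T (\<lambda>x t. thx x t * dx \<phi> x t)
          + \<beta> * Qint L T (\<lambda>x t. ux x t * \<phi> x t) = Qint L T (\<lambda>x t. h x t * \<phi> x t)"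
      using th_heat[OF \<phi> bd] unfolding Qh[OF c(1)] by simp
  qed
  with Lg show ?thesis by blast
qed

end
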